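(* For any $t>0$ and $y\in Y$, $$0\le t\sum_{i=1}^2\omega\left(\|x_i^*(y,t)-x_i^c\|_{x_i^c}\right)\le d_0(y)-d(y,t)\le t\left[\bar\zeta(K_1;\nu_1,t)+\bar\zeta(K_2;\nu_2,t)\right],$$ where $\bar\zeta(\tau;a,b) := a\left(1+\max\left\{0,\ln\left(\frac{\tau}{ab}\right)\right\}\right)$ and, for $i=1,2$, $$K_i := (\nu_i+2\sqrt{\nu_i})\,\sup_{y\in Y}\ \max_{\xi_i\in\partial\phi_i(x_i^c)}\|\xi_i+A_i^Ty\|^*_{x_i^c}.$$
   Context: Setting and assumptions. For $i=1,2$: $X_i\subset\mathbb{R}^{n_i}$ is a bounded closed convex set with nonempty interior; $F_i$ is a self-concordant barrier for $X_i$ with parameter $\nu_i$ (standard self-concordant, i.e. $|D^3F_i(x)[h,h,h]|\le 2(h^T\nabla^2F_i(x)h)^{3/2}$, with domain $\mathrm{int}(X_i)$, tending to $+\infty$ at the boundary, and $(\nabla F_i(x)^Th)^2\le\nu_i\,h^T\nabla^2F_i(x)h$); $\phi_i:\mathbb{R}^{n_i}\to\mathbb{R}$ is concave, proper and upper semicontinuous on $X_i$; $A_i\in\mathbb{R}^{m\times n_i}$, $b\in\mathbb{R}^m$, and $A=[A_1,A_2]$ has full row rank. With $X=X_1\times X_2$ and $\phi(x)=\phi_1(x_1)+\phi_2(x_2)$, the problem $\max\{\phi(x): Ax=b,\ x\in X\}$ has a nonempty solution set, and either the Slater condition ($\mathrm{ri}(X)\cap\{Ax=b\}\ne\emptyset$)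 holds or $X$ is polyhedral. Notation. $x_i^c=\arg\min_{\mathrm{int}(X_i)}F_i$ (analytic center). $d_0(y)=\max_{x\in X}\{\phi(x)+y^T(Ax-b)\}$; $Y\subset\mathbb{R}^m$ is a bounded set containing the set $Y^*$ of minimizers of $d_0$ over $\mathbb{R}^m$. For $t>0$: $d_i(y,t)=\max_{x_i\in\mathrm{int}(X_i)}\{\phi_i(x_i)+y^TA_ix_i-t[F_i(x_i)-F_i(x_i^c)]\}$ with unique maximizer $x_i^*(y,t)$, and $d(y,t)=d_1(y,t)+d_2(y,t)-b^Ty$. Local norms: $\|u\|_{x_i}=(u^T\nabla^2F_i(x_i)u)^{1/2}$, $\|u\|^*_{x_i}=(u^T\nabla^2F_i(x_i)^{-1}u)^{1/2}$. $\partial\phi_i(x)$ is the superdifferential $-\partial(-\phi_i)(x)$ of the concave function $\phi_i$. $\omega(s)=s-\ln(1+s)$. Convention: $\max\{0,\ln 0\}=0$. *)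

theory Defs
  imports "HOL-Analysis.Analysis"
begin

definition grad :: "('a::real_inner \<Rightarrow> real) \<Rightarrow> 'a \<Rightarrow> 'a" where
  "grad F x = (SOME g. GDERIV F x :> g)"

definition hess :: "(real^'n \<Rightarrow> real) \<Rightarrow> real^'n \<Rightarrow> real^'n^'n" where
  "hess F x = jacobian (grad F) (at x)"

text \<open>The third directional derivative $D^3F(x)[h,h,h]$, i.e. the derivative of
  $x \mapsto h^T \nabla^2 F(x) h$ at $x$ in direction $h$.\<close>

definition D3 :: "(real^'n \<Rightarrow> real) \<Rightarrow> real^'n \<Rightarrow> real^'n \<Rightarrow> real" where
  "D3 F x h = h \<bullet> (frechet_derivative (hess F) (at x) h *v h)"

text \<open>Three times continuously differentiable on an open set.\<close>

definition C3_on :: "(real^'n \<Rightarrow> real) \<Rightarrow> (real^'n) set \<Rightarrow> bool" where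
  "C3_on F U \<longleftrightarrow>
     F differentiable_on U \<and> grad F differentiable_on U \<and> hess F differentiable_on U \<and>
     (\<forall>h. continuous_on U (\<lambda>x. frechet_derivative (hess F) (at x) h))"

text \<open>The domain of \<open>F\<close> is the interior of \<open>X\<close>; values of \<open>F\<close> elsewhere are irrelevant.\<close>

definition self_concordant_barrier ::
    "(real^'n \<Rightarrow> real) \<Rightarrow> (real^'n) set \<Rightarrow> real \<Rightarrow> bool" where
  "self_concordant_barrier F X \<nu> \<longleftrightarrow>
     convex_on (interior X) F \<and> C3_on F (interior X) \<and>
     (\<forall>x\<in>interior X. \<forall>h. \<bar>D3 F x h\<bar> \<le> 2 * (h \<bullet> (hess F x *v h)) powr (3/2)) \<and>
     (\<forall>z\<in>frontier X. filterlim F at_top (at z within interior X)) \<and>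
     (\<forall>x\<in>interior X. \<forall>h. (grad F x \<bullet> h)\<^sup>2 \<le> \<nu> * (h \<bullet> (hess F x *v h)))"

definition analytic_center :: "(real^'n \<Rightarrow> real) \<Rightarrow> (real^'n) set \<Rightarrow> real^'n" where
  "analytic_center F X = arg_min_on F (interior X)"

definition local_norm :: "(real^'n \<Rightarrow> real) \<Rightarrow> real^'n \<Rightarrow> real^'n \<Rightarrow> real" where
  "local_norm F x u = sqrt (u \<bullet> (hess F x *v u))"

definition dual_local_norm :: "(real^'n \<Rightarrow> real) \<Rightarrow> real^'n \<Rightarrow> real^'n \<Rightarrow> real" where
  "dual_local_norm F x u = sqrt (u \<bullet> (matrix_inv (hess F x) *v u))"

definition usc_on :: "'a::topological_space set \<Rightarrow> ('a \<Rightarrow> real) \<Rightarrow> bool" where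
  "usc_on S f \<longleftrightarrow> (\<forall>x\<in>S. \<forall>c. f x < c \<longrightarrow> (\<forall>\<^sub>F z in at x within S. f z < c))"

text \<open>Sub- and superdifferential of a function with effective domain \<open>D\<close>; for
  \<open>D = UNIV\<close> these are the ones of a finite function on the whole space.\<close>

definition subdifferential :: "'a::real_inner set \<Rightarrow> ('a \<Rightarrow> real) \<Rightarrow> 'a \<Rightarrow> 'a set" where
  "subdifferential D f x = {g. \<forall>z\<in>D. f x + g \<bullet> (z - x) \<le> f z}"

definition superdifferential :: "'a::real_inner set \<Rightarrow> ('a \<Rightarrow> real) \<Rightarrow> 'a \<Rightarrow> 'a set" where
  "superdifferential D f x = uminus ` subdifferential D (\<lambda>z. - f z) x"

definition block_row :: "real^'n1^'m \<Rightarrow> real^'n2^'m \<Rightarrow> real^('n1 + 'n2)^'m" where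
  "block_row A1 A2 = (\<chi> i j. case j of Inl k \<Rightarrow> A1 $ i $ k | Inr k \<Rightarrow> A2 $ i $ k)"

definition feasible_plane ::
    "real^'n1^'m \<Rightarrow> real^'n2^'m \<Rightarrow> real^'m \<Rightarrow> ((real^'n1) \<times> (real^'n2)) set" where
  "feasible_plane A1 A2 b = {x. A1 *v fst x + A2 *v snd x = b}"

definition primal_solutions ::
    "(real^'n1 \<Rightarrow> real) \<Rightarrow> (real^'n2 \<Rightarrow> real) \<Rightarrow> (real^'n1) set \<Rightarrow> (real^'n2) set \<Rightarrow>
     real^'n1^'m \<Rightarrow> real^'n2^'m \<Rightarrow> real^'m \<Rightarrow> ((real^'n1) \<times> (real^'n2)) set" where
  "primal_solutions \<phi>1 \<phi>2 X1 X2 A1 A2 b =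
     {x. is_arg_max (\<lambda>x. \<phi>1 (fst x) + \<phi>2 (snd x))
           (\<lambda>x. x \<in> X1 \<times> X2 \<and> x \<in> feasible_plane A1 A2 b) x}"

text \<open>Maxima are written as suprema. The supremum here is that of an upper semicontinuous
  function over a compact set.\<close>

definition dual_fun ::
    "(real^'n1 \<Rightarrow> real) \<Rightarrow> (real^'n2 \<Rightarrow> real) \<Rightarrow> (real^'n1) set \<Rightarrow> (real^'n2) set \<Rightarrow>
     real^'n1^'m \<Rightarrow> real^'n2^'m \<Rightarrow> real^'m \<Rightarrow> real^'m \<Rightarrow> real" where
  "dual_fun \<phi>1 \<phi>2 X1 X2 A1 A2 b y =
     (SUP x\<in>X1 \<times> X2. \<phi>1 (fst x) + \<phi>2 (snd x) + y \<bullet> (A1 *v fst x + A2 *v snd x - b))"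

definition dual_minimizers ::
    "(real^'n1 \<Rightarrow> real) \<Rightarrow> (real^'n2 \<Rightarrow> real) \<Rightarrow> (real^'n1) set \<Rightarrow> (real^'n2) set \<Rightarrow>
     real^'n1^'m \<Rightarrow> real^'n2^'m \<Rightarrow> real^'m \<Rightarrow> (real^'m) set" where
  "dual_minimizers \<phi>1 \<phi>2 X1 X2 A1 A2 b =
     {y. is_arg_min (dual_fun \<phi>1 \<phi>2 X1 X2 A1 A2 b) (\<lambda>_. True) y}"

definition smoothed_obj ::
    "(real^'n \<Rightarrow> real) \<Rightarrow> (real^'n \<Rightarrow> real) \<Rightarrow> (real^'n) set \<Rightarrow> real^'n^'m \<Rightarrow>
     real^'m \<Rightarrow> real \<Rightarrow> real^'n \<Rightarrow> real" where
  "smoothed_obj \<phi> F X A y t x =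
     \<phi> x + y \<bullet> (A *v x) - t * (F x - F (analytic_center F X))"

definition smoothed_max ::
    "(real^'n \<Rightarrow> real) \<Rightarrow> (real^'n \<Rightarrow> real) \<Rightarrow> (real^'n) set \<Rightarrow> real^'n^'m \<Rightarrow>
     real^'m \<Rightarrow> real \<Rightarrow> real" where
  "smoothed_max \<phi> F X A y t = (SUP x\<in>interior X. smoothed_obj \<phi> F X A y t x)"

definition smoothed_argmax ::
    "(real^'n \<Rightarrow> real) \<Rightarrow> (real^'n \<Rightarrow> real) \<Rightarrow> (real^'n) set \<Rightarrow> real^'n^'m \<Rightarrow>
     real^'m \<Rightarrow> real \<Rightarrow> real^'n" where
  "smoothed_argmax \<phi> F X A y t = arg_max_on (smoothed_obj \<phi> F X A y t) (interior X)"

definition smoothed_dual_fun ::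
    "(real^'n1 \<Rightarrow> real) \<Rightarrow> (real^'n2 \<Rightarrow> real) \<Rightarrow> (real^'n1 \<Rightarrow> real) \<Rightarrow> (real^'n2 \<Rightarrow> real) \<Rightarrow>
     (real^'n1) set \<Rightarrow> (real^'n2) set \<Rightarrow>
     real^'n1^'m \<Rightarrow> real^'n2^'m \<Rightarrow> real^'m \<Rightarrow> real^'m \<Rightarrow> real \<Rightarrow> real" where
  "smoothed_dual_fun \<phi>1 \<phi>2 F1 F2 X1 X2 A1 A2 b y t =
     smoothed_max \<phi>1 F1 X1 A1 y t + smoothed_max \<phi>2 F2 X2 A2 y t - b \<bullet> y"

definition omega :: "real \<Rightarrow> real" where
  "omega s = s - ln (1 + s)"

text \<open>The conditional spells out the convention $\max\{0, \ln 0\} = 0$.\<close>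

definition zeta_bar :: "real \<Rightarrow> real \<Rightarrow> real \<Rightarrow> real" where
  "zeta_bar \<tau> a c = a * (1 + (if \<tau> / (a * c) = 0 then 0 else max 0 (ln (\<tau> / (a * c)))))"

text \<open>\<open>D\<close> is the effective domain of \<open>\<phi>\<close>. The center is interior to \<open>D\<close>, so the
  superdifferential there is nonempty and compact.\<close>

definition K_const ::
    "(real^'n) set \<Rightarrow> (real^'n \<Rightarrow> real) \<Rightarrow> (real^'n \<Rightarrow> real) \<Rightarrow> (real^'n) set \<Rightarrow>
     real \<Rightarrow> real^'n^'m \<Rightarrow> (real^'m) set \<Rightarrow> real" where
  "K_const D \<phi> F X \<nu> A Y =
     (let xc = analytic_center F X in
      (\<nu> + 2 * sqrt \<nu>) *
        (SUP y\<in>Y. SUP \<xi>\<in>superdifferential D \<phi> xc.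
           dual_local_norm F xc (\<xi> + transpose A *v y)))"

end

theory Submission
  imports Defs
begin

text \<open>
  The dual functions split into one term per block, so a single block with barrier \<open>F\<close>, analytic
  center $c$ and concave Lagrangian $g(x) = \phi(x) + y^T A x$ is enough. Let $m$ maximize $g$ over
  \<open>X\<close> and let $x^*$ maximize $g - t (F - F(c))$ over the interior. The gap of the block is
  $g(m) - g(x^*) + t (F(x^*) - F(c))$.

  Lower bound: $g(x^*) \le g(m)$, and a self-concordant function exceeds its minimum by at least
  $\omega$ of the local distance to the minimizer (\<open>omega_lower_bound\<close>).

  Upper bound: on the segment from $c$ to $m$ the barrier grows at most logarithmically
  (\<open>growth_bound\<close>) while $g$ is concave. At the point with the fraction $\tau$ of the segment left
  this bounds the gap by $\tau\delta - t\nu\ln\tau$, where $\delta = g(m) - g(c)$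
  (\<open>smoothing_gap_le\<close>). The best $\tau$ gives the shape of $\bar\zeta$ with $\delta$ in place of
  $K$. Finally $\delta \le K$ (\<open>lagrangian_gain_le_K_const\<close>): a supergradient of $g$ at $c$ bounds
  the gain, the local norm and its dual separate supergradient and displacement, and the whole of
  \<open>X\<close> lies within local distance $\nu + 2\sqrt\nu$ of the center
  (\<open>body_within_local_radius\<close>).

  Every property of the barrier that enters is a statement on its restriction $p$ to a line,
  obtained from $|p'''| \le 2 (p'')^{3/2}$ and $(p')^2 \le \nu p''$ by integrating once or twice.
  The duality of the local norms requires in addition that the Hessian is symmetric, which is the
  symmetry of second derivatives (\<open>hess_symmetric\<close>), and positive definite (\<open>hess_pos\<close>): a
  direction of zero curvature would remain one up to the boundary, where \<open>F\<close> could not blow up.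
\<close>

section \<open>Self-concordant barriers on an interval\<close>

lemma omega_nonneg: "0 \<le> s \<Longrightarrow> 0 \<le> omega s"
  using ln_add_one_self_le_self[of s] by (simp add: omega_def)

text \<open>A positive slope stays positive, and the barrier inequality says that its reciprocal $1/p'$
  decreases at rate at least $1/\nu$. The reciprocal is positive up to the end \<open>T\<close> of the interval, so it must be at least
  $(T-s)/\nu$ at \<open>s\<close>.\<close>

lemma barrier_slope_bound:
  fixes p1 p2 :: "real \<Rightarrow> real"
  assumes "s < T" "0 < \<nu>"
    and deriv: "\<And>u. s \<le> u \<Longrightarrow> u < T \<Longrightarrow> (p1 has_real_derivative p2 u) (at u)"
    and bound: "\<And>u. s \<le> u \<Longrightarrow> u < T \<Longrightarrow> (p1 u)\<^sup>2 \<le> \<nu> * p2 u"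
  shows "p1 s * (T - s) \<le> \<nu>"
proof (cases "p1 s > 0")
  case False
  then have "p1 s * (T - s) \<le> 0"
    using assms(1) by (simp add: mult_nonpos_nonneg)
  then show ?thesis using assms(2) by linarith
next
  case True
  have nonneg: "0 \<le> p2 u" if "s \<le> u" "u < T" for u
    using bound[OF that] assms(2) by (smt (verit) zero_le_power2 zero_le_mult_iff)
  have pos: "0 < p1 u" if "s \<le> u" "u < T" for u
  proof -
    have "p1 s \<le> p1 u"
      by (rule DERIV_nonneg_imp_nondecreasing[OF that(1)]) (use deriv nonneg that in force)
    then show ?thesis using True by simp
  qed
  have less: "u - s \<le> \<nu> / p1 s" if u: "s \<le> u" "u < T" for u
  proof -
    have "1 / p1 u + u / \<nu> \<le> 1 / p1 s + s / \<nu>"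
    proof (rule DERIV_nonpos_imp_nonincreasing[OF u(1)])
      fix v assume v: "s \<le> v" "v \<le> u"
      then have "v < T" using u by simp
      have "((\<lambda>v. 1 / p1 v + v / \<nu>) has_real_derivative - (p2 v / (p1 v)\<^sup>2) + 1 / \<nu>) (at v)"
        using deriv[OF v(1) \<open>v < T\<close>] pos[OF v(1) \<open>v < T\<close>] assms(2)
        by (auto intro!: derivative_eq_intros simp: power2_eq_square)
      moreover have "- (p2 v / (p1 v)\<^sup>2) + 1 / \<nu> \<le> 0"
        using bound[OF v(1) \<open>v < T\<close>] pos[OF v(1) \<open>v < T\<close>] assms(2)
        by (simp add: field_simps)
      ultimately show "\<exists>y. ((\<lambda>v. 1 / p1 v + v / \<nu>) has_real_derivative y) (at v) \<and> y \<le> 0"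
        by blast
    qed
    then have "(u - s) / \<nu> \<le> 1 / p1 s"
      using pos[OF u] by (simp add: diff_divide_distrib) (smt (verit) divide_nonneg_pos)
    then show ?thesis using assms(2) True by (simp add: field_simps)
  qed
  have "T \<le> s + \<nu> / p1 s"
  proof (rule dense_le)
    fix u assume "u < T"
    show "u \<le> s + \<nu> / p1 s"
    proof (cases "s \<le> u")
      case True with less[of u] \<open>u < T\<close> show ?thesis by simp
    next
      case F: False
      have "0 \<le> \<nu> / p1 s" using True assms(2) by simp
      with F show ?thesis by linarith
    qed
  qed
  then show ?thesis using True by (simp add: field_simps)
qed

text \<open>Integration of the slope bound $p'(u) \le \nu/(1-u)$: a barrier grows no faster than
  $-\nu \ln$ of the fraction of the segment that remains.\<close>

lemma barrier_growth_bound: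
  fixes p p1 p2 :: "real \<Rightarrow> real"
  assumes "0 \<le> s" "s < 1" "0 < \<nu>"
    and d0: "\<And>u. 0 \<le> u \<Longrightarrow> u < 1 \<Longrightarrow> (p has_real_derivative p1 u) (at u)"
    and d1: "\<And>u. 0 \<le> u \<Longrightarrow> u < 1 \<Longrightarrow> (p1 has_real_derivative p2 u) (at u)"
    and bound: "\<And>u. 0 \<le> u \<Longrightarrow> u < 1 \<Longrightarrow> (p1 u)\<^sup>2 \<le> \<nu> * p2 u"
  shows "p s \<le> p 0 - \<nu> * ln (1 - s)"
proof -
  have "p s + \<nu> * ln (1 - s) \<le> p 0 + \<nu> * ln (1 - 0)"
  proof (rule DERIV_nonpos_imp_nonincreasing[OF assms(1)])
    fix u assume u: "0 \<le> u" "u \<le> s"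
    then have "u < 1" using assms(2) by simp
    have "((\<lambda>u. p u + \<nu> * ln (1 - u)) has_real_derivative p1 u - \<nu> / (1 - u)) (at u)"
      using \<open>u < 1\<close> u by (auto intro!: derivative_eq_intros d0)
    moreover have "p1 u * (1 - u) \<le> \<nu>"
      by (rule barrier_slope_bound[OF \<open>u < 1\<close> assms(3) d1 bound]) (use u in auto)
    then have "p1 u - \<nu> / (1 - u) \<le> 0"
      using \<open>u < 1\<close> by (simp add: field_simps)
    ultimately show "\<exists>y. ((\<lambda>u. p u + \<nu> * ln (1 - u)) has_real_derivative y) (at u) \<and> y \<le> 0"
      by blast
  qed
  then show ?thesis by simp
qed

lemma powr_three_halves: "0 < x \<Longrightarrow> x powr (3/2) = x * sqrt x"
proof -
  assume "0 < x"
  then have "x * sqrt x = x powr 1 * x powr (1/2)" by (simp add: powr_half_sqrt)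
  also have "\<dots> = x powr (3/2)" by (simp only: powr_add[symmetric]) simp
  finally show ?thesis by simp
qed

text \<open>Self-concordance is the statement that $1/\sqrt{p''}$ is Lipschitz with constant one.\<close>

lemma self_concordant_curvature_bound:
  fixes p2 p3 :: "real \<Rightarrow> real"
  assumes "0 \<le> s"
    and deriv: "\<And>u. 0 \<le> u \<Longrightarrow> u \<le> s \<Longrightarrow> (p2 has_real_derivative p3 u) (at u)"
    and pos: "\<And>u. 0 \<le> u \<Longrightarrow> u \<le> s \<Longrightarrow> 0 < p2 u"
    and sc: "\<And>u. 0 \<le> u \<Longrightarrow> u \<le> s \<Longrightarrow> \<bar>p3 u\<bar> \<le> 2 * p2 u powr (3/2)"
  shows "p2 0 / (1 + s * sqrt (p2 0))\<^sup>2 \<le> p2 s"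
proof -
  have "1 / sqrt (p2 s) - s \<le> 1 / sqrt (p2 0) - 0"
  proof (rule DERIV_nonpos_imp_nonincreasing[OF assms(1)])
    fix u assume u: "0 \<le> u" "u \<le> s"
    let ?y = "- (p3 u / (2 * (p2 u * sqrt (p2 u)))) - 1"
    have "((\<lambda>u. 1 / sqrt (p2 u) - u) has_real_derivative ?y) (at u)"
      using deriv[OF u] pos[OF u]
      by (auto intro!: derivative_eq_intros simp: field_simps)
    moreover have "\<bar>p3 u\<bar> \<le> 2 * (p2 u * sqrt (p2 u))"
      using sc[OF u] pos[OF u] by (simp add: powr_three_halves)
    then have "?y \<le> 0"
      using pos[OF u] by (simp add: field_simps abs_le_iff)
    ultimately show "\<exists>y. ((\<lambda>u. 1 / sqrt (p2 u) - u) has_real_derivative y) (at u) \<and> y \<le> 0"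
      by blast
  qed
  moreover define a b where "a = sqrt (p2 0)" and "b = sqrt (p2 s)"
  moreover have ab: "0 < a" "0 < b"
    using pos[of 0] pos[of s] assms(1) by (auto simp: a_def b_def)
  ultimately have "a \<le> b * (1 + s * a)" by (simp add: field_simps)
  moreover have c: "0 < 1 + s * a" using ab assms(1) by (simp add: add_pos_nonneg)
  ultimately have "a / (1 + s * a) \<le> b" by (simp add: field_simps)
  then have "(a / (1 + s * a))\<^sup>2 \<le> b\<^sup>2"
    using ab c by (intro power_mono) auto
  then show ?thesis
    using pos[of 0] pos[of s] assms(1) by (simp add: a_def b_def power_divide)
qed

text \<open>The integral of the curvature bound; a second integration gives the bound by \<^const>\<open>omega\<close>
  that follows.\<close>

lemma self_concordant_slope_bound:
  fixes p1 p2 p3 :: "real \<Rightarrow> real"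
  assumes "0 \<le> s"
    and d1: "\<And>u. 0 \<le> u \<Longrightarrow> u \<le> s \<Longrightarrow> (p1 has_real_derivative p2 u) (at u)"
    and d2: "\<And>u. 0 \<le> u \<Longrightarrow> u \<le> s \<Longrightarrow> (p2 has_real_derivative p3 u) (at u)"
    and pos: "\<And>u. 0 \<le> u \<Longrightarrow> u \<le> s \<Longrightarrow> 0 < p2 u"
    and sc: "\<And>u. 0 \<le> u \<Longrightarrow> u \<le> s \<Longrightarrow> \<bar>p3 u\<bar> \<le> 2 * p2 u powr (3/2)"
  shows "p1 0 + s * p2 0 / (1 + s * sqrt (p2 0)) \<le> p1 s"
proof -
  define r where "r = sqrt (p2 0)"
  have r: "0 < r" "p2 0 = r * r" using pos[of 0] assms(1) by (auto simp: r_def)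
  have "p1 0 - 0 * p2 0 / (1 + 0 * r) \<le> p1 s - s * p2 0 / (1 + s * r)"
  proof (rule DERIV_nonneg_imp_nondecreasing[OF assms(1)])
    fix u assume u: "0 \<le> u" "u \<le> s"
    have c: "0 < 1 + u * r" using r u by (simp add: add_pos_nonneg)
    have "((\<lambda>u. p1 u - u * p2 0 / (1 + u * r)) has_real_derivative
        p2 u - p2 0 / (1 + u * r)\<^sup>2) (at u)"
      using d1[OF u] c
      by (auto intro!: derivative_eq_intros simp: field_simps power2_eq_square)
    moreover have "0 \<le> p2 u - p2 0 / (1 + u * r)\<^sup>2"
      using self_concordant_curvature_bound[of u p2 p3, OF u(1) d2 pos sc] u by (simp add: r_def)
    ultimately show "\<exists>y. ((\<lambda>u. p1 u - u * p2 0 / (1 + u * r)) has_real_derivative y) (at u) \<and> 0 \<le> y"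
      by blast
  qed
  then show ?thesis by (simp add: r_def)
qed

lemma self_concordant_lower_bound:
  fixes p p1 p2 p3 :: "real \<Rightarrow> real"
  assumes "0 \<le> s"
    and d0: "\<And>u. 0 \<le> u \<Longrightarrow> u \<le> s \<Longrightarrow> (p has_real_derivative p1 u) (at u)"
    and d1: "\<And>u. 0 \<le> u \<Longrightarrow> u \<le> s \<Longrightarrow> (p1 has_real_derivative p2 u) (at u)"
    and d2: "\<And>u. 0 \<le> u \<Longrightarrow> u \<le> s \<Longrightarrow> (p2 has_real_derivative p3 u) (at u)"
    and pos: "\<And>u. 0 \<le> u \<Longrightarrow> u \<le> s \<Longrightarrow> 0 < p2 u"
    and sc: "\<And>u. 0 \<le> u \<Longrightarrow> u \<le> s \<Longrightarrow> \<bar>p3 u\<bar> \<le> 2 * p2 u powr (3/2)"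
  shows "p 0 + s * p1 0 + omega (s * sqrt (p2 0)) \<le> p s"
proof -
  define r where "r = sqrt (p2 0)"
  have r: "0 < r" "p2 0 = r * r" using pos[of 0] assms(1) by (auto simp: r_def)
  have "p 0 - 0 * p1 0 - omega (0 * r) \<le> p s - s * p1 0 - omega (s * r)"
  proof (rule DERIV_nonneg_imp_nondecreasing[OF assms(1)])
    fix u assume u: "0 \<le> u" "u \<le> s"
    have c: "0 < 1 + u * r" using r u by (simp add: add_pos_nonneg)
    have "((\<lambda>u. p u - u * p1 0 - omega (u * r)) has_real_derivative
        p1 u - p1 0 - u * p2 0 / (1 + u * r)) (at u)"
      unfolding omega_def using d0[OF u] c r(2)
      by (auto intro!: derivative_eq_intros simp: field_simps)
    moreover have "0 \<le> p1 u - p1 0 - u * p2 0 / (1 + u * r)"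
      using self_concordant_slope_bound[of u p1 p2 p3, OF u(1) d1 d2 pos sc] u by (simp add: r_def)
    ultimately show "\<exists>y. ((\<lambda>u. p u - u * p1 0 - omega (u * r)) has_real_derivative y) (at u) \<and> 0 \<le> y"
      by blast
  qed
  then show ?thesis by (simp add: r_def omega_def)
qed

text \<open>On a compact interval $p''$ has a maximum $M^2$, so $|p'''| \le 2 (p'')^{3/2}$ becomes the linear
  inequality $p''' \le 2 M p''$, and Gronwall's argument keeps a zero of $p''$ zero.\<close>

lemma self_concordant_flat_propagates:
  fixes p2 p3 :: "real \<Rightarrow> real"
  assumes "0 \<le> s" "p2 0 = 0"
    and deriv: "\<And>u. 0 \<le> u \<Longrightarrow> u \<le> s \<Longrightarrow> (p2 has_real_derivative p3 u) (at u)"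
    and nonneg: "\<And>u. 0 \<le> u \<Longrightarrow> u \<le> s \<Longrightarrow> 0 \<le> p2 u"
    and sc: "\<And>u. 0 \<le> u \<Longrightarrow> u \<le> s \<Longrightarrow> \<bar>p3 u\<bar> \<le> 2 * p2 u powr (3/2)"
  shows "p2 s = 0"
proof -
  have "continuous_on {0..s} p2"
    by (intro continuous_at_imp_continuous_on ballI DERIV_isCont[OF deriv]) auto
  then have "\<exists>m\<in>{0..s}. \<forall>u\<in>{0..s}. p2 u \<le> p2 m"
    using assms(1) by (intro continuous_attains_sup) auto
  then obtain m where m: "\<And>u. u \<in> {0..s} \<Longrightarrow> p2 u \<le> p2 m" by blast
  define M where "M = sqrt (p2 m)"
  have "p2 s * exp (- 2 * M * s) \<le> p2 0 * exp (- 2 * M * 0)"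
  proof (rule DERIV_nonpos_imp_nonincreasing[OF assms(1)])
    fix u assume u: "0 \<le> u" "u \<le> s"
    have "((\<lambda>u. p2 u * exp (- 2 * M * u)) has_real_derivative
        (p3 u - 2 * M * p2 u) * exp (- 2 * M * u)) (at u)"
      using deriv[OF u] by (auto intro!: derivative_eq_intros simp: field_simps)
    moreover have "p3 u \<le> 2 * M * p2 u"
    proof (cases "p2 u = 0")
      case True then show ?thesis using sc[OF u] by simp
    next
      case False
      then have "0 < p2 u" using nonneg[OF u] by simp
      have "p3 u \<le> 2 * (p2 u * sqrt (p2 u))"
        using sc[OF u] \<open>0 < p2 u\<close> by (simp add: powr_three_halves)
      also have "\<dots> \<le> 2 * (p2 u * M)"
        using m[of u] u \<open>0 < p2 u\<close> by (simp add: M_def)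
      finally show ?thesis by (simp add: mult_ac)
    qed
    then have "(p3 u - 2 * M * p2 u) * exp (- 2 * M * u) \<le> 0"
      by (simp add: mult_nonpos_nonneg)
    ultimately show "\<exists>y. ((\<lambda>u. p2 u * exp (- 2 * M * u)) has_real_derivative y) (at u) \<and> y \<le> 0"
      by blast
  qed
  then have "p2 s * exp (- 2 * M * s) \<le> 0" using assms(2) by simp
  then have "p2 s \<le> 0" by (simp add: mult_le_0_iff)
  with nonneg[OF assms(1) order_refl] show ?thesis by simp
qed

section \<open>Maxima of upper semicontinuous functions\<close>

lemma usc_on_attains_max:
  fixes f :: "'a::topological_space \<Rightarrow> real"
  assumes "compact S" "S \<noteq> {}" "usc_on S f"
  obtains m where "m \<in> S" "\<And>x. x \<in> S \<Longrightarrow> f x \<le> f m"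
proof (rule ccontr)
  assume "\<not> thesis"
  with that have "\<forall>x\<in>S. \<exists>w\<in>S. f x < f w" by (meson not_le)
  \<comment> \<open>Without a maximum the sets where \<open>f\<close> is below one of its values cover \<open>S\<close>;
    a finite subfamily misses the point with the largest of its values.\<close>
  then obtain w where w: "\<And>x. x \<in> S \<Longrightarrow> w x \<in> S \<and> f x < f (w x)" by metis
  have "\<exists>U. open U \<and> x \<in> U \<and> (\<forall>z\<in>U \<inter> S. f z < f (w x))" if "x \<in> S" for x
  proof -
    have "\<forall>\<^sub>F z in at x within S. f z < f (w x)"
      using assms(3) w[OF that] that by (auto simp: usc_on_def)
    then obtain U where "open U" "x \<in> U" "\<forall>z\<in>U. z \<noteq> x \<longrightarrow> z \<in> S \<longrightarrow> f z < f (w x)"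
      unfolding eventually_at_topological by blast
    then show ?thesis using w[OF that] by (intro exI[of _ U]) auto
  qed
  then obtain U where U: "\<And>x. x \<in> S \<Longrightarrow> open (U x) \<and> x \<in> U x \<and> (\<forall>z\<in>U x \<inter> S. f z < f (w x))"
    by metis
  obtain C where C: "C \<subseteq> S" "finite C" "S \<subseteq> (\<Union>c\<in>C. U c)"
    by (rule compactE_image[OF assms(1), of S U]) (use U in auto)
  then have "C \<noteq> {}" using assms(2) by auto
  have fin: "finite ((\<lambda>c. f (w c)) ` C)" using C(2) by simp
  then have "Max ((\<lambda>c. f (w c)) ` C) \<in> (\<lambda>c. f (w c)) ` C"
    using \<open>C \<noteq> {}\<close> by (intro Max_in) auto
  then obtain m where m: "m \<in> C" "Max ((\<lambda>c. f (w c)) ` C) = f (w m)" by auto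
  have m_max: "f (w c) \<le> f (w m)" if "c \<in> C" for c
    using Max_ge[OF fin imageI[OF that]] m(2) by simp
  have "w m \<in> S" using w m(1) C(1) by auto
  then obtain c where c: "c \<in> C" "w m \<in> U c" using C(3) by auto
  then have "f (w m) < f (w c)" using U[of c] C(1) \<open>w m \<in> S\<close> by auto
  with m_max[OF c(1)] show False by simp
qed

lemma usc_on_add_continuous:
  fixes f g :: "'a::topological_space \<Rightarrow> real"
  assumes "usc_on S f" "continuous_on S g"
  shows "usc_on S (\<lambda>x. f x + g x)"
  unfolding usc_on_def
proof (intro ballI allI impI)
  fix x c assume x: "x \<in> S" "f x + g x < c"
  define e where "e = (c - (f x + g x)) / 2"
  have e: "0 < e" "c = f x + g x + 2 * e" using x by (auto simp: e_def field_simps)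
  have "\<forall>\<^sub>F z in at x within S. f z < f x + e"
    using assms(1) x e unfolding usc_on_def by auto
  moreover have "\<forall>\<^sub>F z in at x within S. g z < g x + e"
    using assms(2) x e unfolding continuous_on_def
    by (auto intro: order_tendstoD(2))
  ultimately show "\<forall>\<^sub>F z in at x within S. f z + g z < c"
    by eventually_elim (simp add: e)
qed

lemma usc_on_subset: "usc_on S f \<Longrightarrow> T \<subseteq> S \<Longrightarrow> usc_on T f"
  unfolding usc_on_def by (meson at_le filter_leD subset_iff)

text \<open>A function that tends to $-\infty$ at the boundary may be cut off below at one of its values and
  extended to the whole of \<open>X\<close> by that value. The extension is upper semicontinuous on a compact
  set, and its maximizer can be taken in the interior.\<close>

lemma usc_on_interior_attains_max:
  fixes f :: "'a::euclidean_space \<Rightarrow> real"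
  assumes "compact X" "interior X \<noteq> {}" and usc: "usc_on (interior X) f"
    and coercive: "\<And>z. z \<in> frontier X \<Longrightarrow> filterlim f at_bot (at z within interior X)"
  obtains m where "m \<in> interior X" "\<And>x. x \<in> interior X \<Longrightarrow> f x \<le> f m"
proof -
  obtain a where a: "a \<in> interior X" using assms(2) by auto
  \<comment> \<open>The cut-off extension; \<open>f a\<close> is the value at an arbitrary interior point.\<close>
  define g where "g x = (if x \<in> interior X then max (f x) (f a) else f a)" for x
  have "usc_on X g"
    unfolding usc_on_def
  proof (intro ballI allI impI)
    fix x c assume x: "x \<in> X" "g x < c"
    then have ac: "f a < c" by (auto simp: g_def split: if_splits)
    have "\<forall>\<^sub>F z in at x within interior X. f z < c"
    proof (cases "x \<in> interior X")
      case True
      then show ?thesis using usc x unfolding usc_on_def by (auto simp: g_def)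
    next
      case False
      then have "x \<in> frontier X" using x closure_subset by (auto simp: frontier_def)
      from coercive[OF this] show ?thesis by (simp add: filterlim_at_bot_dense)
    qed
    then have "\<forall>\<^sub>F z in nhds x. z \<noteq> x \<longrightarrow> z \<in> interior X \<longrightarrow> f z < c"
      by (simp add: eventually_at_filter)
    then show "\<forall>\<^sub>F z in at x within X. g z < c"
      unfolding eventually_at_filter by eventually_elim (use ac in \<open>auto simp: g_def\<close>)
  qed
  moreover have "X \<noteq> {}" using a interior_subset by auto
  ultimately obtain m where m: "m \<in> X" "\<And>x. x \<in> X \<Longrightarrow> g x \<le> g m"
    using usc_on_attains_max[OF assms(1)] by blast
  have le: "f x \<le> g m" if "x \<in> interior X" for x
    using m(2)[of x] that interior_subset[of X] by (auto simp: g_def)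
  show thesis
  proof (cases "m \<in> interior X \<and> f a \<le> f m")
    case True
    then show thesis using le by (intro that[of m]) (auto simp: g_def)
  next
    case False
    then have "g m = f a" by (auto simp: g_def)
    then show thesis using le a by (intro that[of a]) auto
  qed
qed

section \<open>Derivatives along lines and symmetry of the Hessian\<close>

lemma GDERIV_grad:
  fixes F :: "'a::euclidean_space \<Rightarrow> real"
  assumes "F differentiable (at x)"
  shows "GDERIV F x :> grad F x"
proof -
  obtain F' where F': "(F has_derivative F') (at x)"
    using assms by (auto simp: differentiable_def)
  have "linear F'" using F' by (rule has_derivative_linear)
  then have "F' = (\<lambda>h. h \<bullet> adjoint F' 1)"
    using adjoint_works[of F' _ 1] by (auto simp: fun_eq_iff)
  with F' have "GDERIV F x :> adjoint F' 1" unfolding gderiv_def by metis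
  then show ?thesis unfolding grad_def by (rule someI)
qed

lemma DERIV_along_line:
  fixes F :: "'a::euclidean_space \<Rightarrow> real"
  assumes "F differentiable (at (x + s *\<^sub>R h))"
  shows "((\<lambda>s. F (x + s *\<^sub>R h)) has_real_derivative grad F (x + s *\<^sub>R h) \<bullet> h) (at s)"
proof -
  have "(F has_derivative (\<lambda>v. v \<bullet> grad F (x + s *\<^sub>R h))) (at (x + s *\<^sub>R h))"
    using GDERIV_grad[OF assms] by (simp add: gderiv_def)
  moreover have "((\<lambda>s. x + s *\<^sub>R h) has_derivative (\<lambda>d. d *\<^sub>R h)) (at s)"
    by (auto intro!: derivative_eq_intros)
  ultimately have "((\<lambda>s. F (x + s *\<^sub>R h)) has_derivative
      (\<lambda>d. (d *\<^sub>R h) \<bullet> grad F (x + s *\<^sub>R h))) (at s)"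
    by (rule has_derivative_compose[rotated])
  then show ?thesis
    by (rule has_derivative_imp_has_field_derivative) (simp add: inner_commute)
qed

lemma has_derivative_grad:
  fixes F :: "real^'n \<Rightarrow> real"
  assumes "grad F differentiable (at x)"
  shows "(grad F has_derivative (\<lambda>h. hess F x *v h)) (at x)"
  using assms unfolding hess_def by (simp add: jacobian_works)

lemma DERIV_grad_along_line:
  fixes F :: "real^'n \<Rightarrow> real"
  assumes "grad F differentiable (at (x + s *\<^sub>R h))"
  shows "((\<lambda>s. grad F (x + s *\<^sub>R h) \<bullet> k) has_real_derivative
      (hess F (x + s *\<^sub>R h) *v h) \<bullet> k) (at s)"
proof -
  have "((\<lambda>s. x + s *\<^sub>R h) has_derivative (\<lambda>d. d *\<^sub>R h)) (at s)"
    by (auto intro!: derivative_eq_intros)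
  from has_derivative_compose[OF this has_derivative_grad[OF assms]]
  have "((\<lambda>s. grad F (x + s *\<^sub>R h) \<bullet> k) has_derivative
      (\<lambda>d. (hess F (x + s *\<^sub>R h) *v (d *\<^sub>R h)) \<bullet> k)) (at s)"
    by (rule has_derivative_inner_left)
  then show ?thesis
    by (rule has_derivative_imp_has_field_derivative) (simp add: matrix_vector_mult_scaleR)
qed

lemma DERIV_hess_along_line:
  fixes F :: "real^'n \<Rightarrow> real"
  assumes "hess F differentiable (at (x + s *\<^sub>R h))"
  shows "((\<lambda>s. h \<bullet> (hess F (x + s *\<^sub>R h) *v h)) has_real_derivative D3 F (x + s *\<^sub>R h) h) (at s)"
proof -
  let ?z = "x + s *\<^sub>R h"
  have H: "(hess F has_derivative frechet_derivative (hess F) (at ?z)) (at ?z)"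
    using assms by (simp add: frechet_derivative_works)
  have L: "linear (\<lambda>M::real^'n^'n. h \<bullet> (M *v h))"
    by (rule linearI) (simp_all add: matrix_vector_mult_add_rdistrib inner_add_right
        scaleR_matrix_vector_assoc[symmetric])
  have "((\<lambda>s. x + s *\<^sub>R h) has_derivative (\<lambda>d. d *\<^sub>R h)) (at s)"
    by (auto intro!: derivative_eq_intros)
  from has_derivative_compose[OF this H]
  have "((\<lambda>s. hess F (x + s *\<^sub>R h)) has_derivative
      (\<lambda>d. frechet_derivative (hess F) (at ?z) (d *\<^sub>R h))) (at s)" .
  from bounded_linear.has_derivative[OF linear_conv_bounded_linear[THEN iffD1, OF L] this]
  have "((\<lambda>s. h \<bullet> (hess F (x + s *\<^sub>R h) *v h)) has_derivative
      (\<lambda>d. h \<bullet> (frechet_derivative (hess F) (at ?z) (d *\<^sub>R h) *v h))) (at s)" .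
  then show ?thesis
    by (rule has_derivative_imp_has_field_derivative)
      (simp add: D3_def linear_cmul[OF has_derivative_linear[OF H]] scaleR_matrix_vector_assoc[symmetric])
qed

text \<open>The second difference is the increment, in the direction \<open>h\<close>, of
  $F(\cdot + sk) - F(\cdot)$. The mean value theorem turns it into $s$ times the increment of
  the gradient between two points that differ by $sk$, and differentiability of the gradient at the
  single point \<open>x\<close> controls this up to $o(s^2)$.\<close>

lemma second_difference_tendsto_hess:
  fixes F :: "real^'n \<Rightarrow> real"
  assumes "open U" "x \<in> U" and F: "\<And>z. z \<in> U \<Longrightarrow> F differentiable (at z)"
    and G: "grad F differentiable (at x)"
  shows "((\<lambda>s. (F (x + s *\<^sub>R h + s *\<^sub>R k) - F (x + s *\<^sub>R h) - F (x + s *\<^sub>R k) + F x) / s\<^sup>2)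
      \<longlongrightarrow> h \<bullet> (hess F x *v k)) (at_right 0)"
proof (rule tendstoI)
  fix e :: real assume "0 < e"
  let ?\<Delta> = "\<lambda>s. F (x + s *\<^sub>R h + s *\<^sub>R k) - F (x + s *\<^sub>R h) - F (x + s *\<^sub>R k) + F x"
  define N where "N = norm h + norm k + 1"
  have N: "1 \<le> N" "norm h \<le> N" "norm k \<le> N" "norm h + norm k \<le> N" by (auto simp: N_def)
  \<comment> \<open>Two remainders of size \<open>\<epsilon> s N\<close> are paired with a vector of norm at most \<open>N\<close>,
    which gives \<open>e / 2\<close> in the end.\<close>
  define \<epsilon> where "\<epsilon> = e / (4 * N\<^sup>2)"
  have "0 < \<epsilon>" using \<open>0 < e\<close> N(1) by (simp add: \<epsilon>_def)
  obtain \<rho> where \<rho>: "0 < \<rho>" "ball x \<rho> \<subseteq> U" using assms(1,2) openE by blast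
  from has_derivative_grad[OF G] \<open>0 < \<epsilon>\<close> obtain \<delta> where \<delta>: "0 < \<delta>"
    "\<And>z. norm (z - x) < \<delta> \<Longrightarrow> norm (grad F z - grad F x - hess F x *v (z - x)) \<le> \<epsilon> * norm (z - x)"
    unfolding has_derivative_at_alt by blast
  define s0 where "s0 = min \<rho> \<delta> / N"
  have "0 < s0" using \<rho> \<delta> N(1) by (simp add: s0_def)
  have "\<forall>\<^sub>F s in at_right 0. 0 < s \<and> s < s0"
    using \<open>0 < s0\<close> eventually_at_right_real[of 0 s0] by (auto elim: eventually_mono)
  then show "\<forall>\<^sub>F s in at_right 0. dist (?\<Delta> s / s\<^sup>2) (h \<bullet> (hess F x *v k)) < e"
  proof eventually_elim
    case (elim s)
    then have sN: "s * N < \<rho>" "s * N < \<delta>"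
      using N(1) by (auto simp: s0_def field_simps)
    have near: "norm (u *\<^sub>R (s *\<^sub>R h) + v *\<^sub>R k) \<le> s * N" if "0 \<le> u" "u \<le> 1" "0 \<le> v" "v \<le> s" for u v
    proof -
      have "norm (u *\<^sub>R (s *\<^sub>R h) + v *\<^sub>R k) \<le> u * (s * norm h) + v * norm k"
        using norm_triangle_ineq[of "u *\<^sub>R (s *\<^sub>R h)" "v *\<^sub>R k"] elim that by simp
      also have "\<dots> \<le> 1 * (s * norm h) + s * norm k"
        using that elim by (intro add_mono mult_right_mono) auto
      also have "\<dots> = s * (norm h + norm k)" by (simp add: algebra_simps)
      also have "\<dots> \<le> s * N" using elim N(4) by (intro mult_left_mono) auto
      finally show ?thesis .
    qed
    define \<psi> where "\<psi> u = F ((x + s *\<^sub>R k) + u *\<^sub>R (s *\<^sub>R h)) - F (x + u *\<^sub>R (s *\<^sub>R h))" for u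
    define \<psi>' where "\<psi>' u = grad F ((x + s *\<^sub>R k) + u *\<^sub>R (s *\<^sub>R h)) \<bullet> (s *\<^sub>R h)
        - grad F (x + u *\<^sub>R (s *\<^sub>R h)) \<bullet> (s *\<^sub>R h)" for u
    have diff: "F differentiable (at (x + w))" if "norm w \<le> s * N" for w
      using F[of "x + w"] \<rho>(2) sN(1) that by (auto simp: subset_iff dist_norm)
    have "\<exists>\<theta>>0. \<theta> < 1 \<and> \<psi> 1 - \<psi> 0 = (1 - 0) * \<psi>' \<theta>"
    proof (rule MVT2)
      fix u :: real assume u: "0 \<le> u" "u \<le> 1"
      have "F differentiable (at ((x + s *\<^sub>R k) + u *\<^sub>R (s *\<^sub>R h)))"
        using diff[OF near[OF u, of s]] elim by (simp add: add_ac)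
      moreover have "F differentiable (at (x + u *\<^sub>R (s *\<^sub>R h)))"
        using diff[OF near[OF u, of 0]] elim by simp
      ultimately show "(\<psi> has_real_derivative \<psi>' u) (at u)"
        unfolding \<psi>_def \<psi>'_def by (intro DERIV_diff DERIV_along_line)
    qed simp
    then obtain \<theta> where \<theta>: "0 < \<theta>" "\<theta> < 1" "\<psi> 1 - \<psi> 0 = \<psi>' \<theta>" by auto
    define z1 z0 where "z1 = x + (\<theta> *\<^sub>R (s *\<^sub>R h) + s *\<^sub>R k)" and "z0 = x + \<theta> *\<^sub>R (s *\<^sub>R h)"
    define r where "r z = grad F z - grad F x - hess F x *v (z - x)" for z
    have r: "norm (r z) \<le> \<epsilon> * (s * N)" if "norm (z - x) \<le> s * N" for z
    proof -
      have "norm (r z) \<le> \<epsilon> * norm (z - x)" using \<delta>(2)[of z] that sN(2) by (simp add: r_def)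
      also have "\<dots> \<le> \<epsilon> * (s * N)" using that \<open>0 < \<epsilon>\<close> by (intro mult_left_mono) auto
      finally show ?thesis .
    qed
    have r1: "norm (r z1) \<le> \<epsilon> * (s * N)"
      using near[of \<theta> s] \<theta> elim by (intro r) (simp add: z1_def)
    have r0: "norm (r z0) \<le> \<epsilon> * (s * N)"
      using near[of \<theta> 0] \<theta> elim by (intro r) (simp add: z0_def)
    have "grad F z1 - grad F z0 = hess F x *v (z1 - z0) + (r z1 - r z0)"
      by (simp add: r_def matrix_vector_mult_diff_distrib)
    also have "z1 - z0 = s *\<^sub>R k" by (simp add: z1_def z0_def)
    finally have g: "grad F z1 - grad F z0 = s *\<^sub>R (hess F x *v k) + (r z1 - r z0)"
      by (simp add: matrix_vector_mult_scaleR)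
    have "?\<Delta> s = \<psi> 1 - \<psi> 0" by (simp add: \<psi>_def add_ac)
    also have "\<dots> = s * ((grad F z1 - grad F z0) \<bullet> h)"
      by (simp add: \<theta>(3) \<psi>'_def z1_def z0_def algebra_simps)
    also have "\<dots> = s\<^sup>2 * (h \<bullet> (hess F x *v k)) + s * ((r z1 - r z0) \<bullet> h)"
      by (simp add: g inner_commute algebra_simps power2_eq_square)
    finally have "?\<Delta> s / s\<^sup>2 - h \<bullet> (hess F x *v k) = ((r z1 - r z0) \<bullet> h) / s"
      using elim by (simp add: field_simps power2_eq_square)
    moreover have "\<bar>(r z1 - r z0) \<bullet> h\<bar> \<le> (2 * (\<epsilon> * (s * N))) * N"
    proof -
      have "\<bar>(r z1 - r z0) \<bullet> h\<bar> \<le> norm (r z1 - r z0) * norm h" by (rule Cauchy_Schwarz_ineq2)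
      also have "\<dots> \<le> (2 * (\<epsilon> * (s * N))) * N"
        using norm_triangle_ineq4[of "r z1" "r z0"] r1 r0 N elim \<open>0 < \<epsilon>\<close>
        by (intro mult_mono) auto
      finally show ?thesis .
    qed
    then have "\<bar>(r z1 - r z0) \<bullet> h\<bar> / s \<le> ((2 * (\<epsilon> * (s * N))) * N) / s"
      using elim by (intro divide_right_mono) auto
    ultimately have "\<bar>?\<Delta> s / s\<^sup>2 - h \<bullet> (hess F x *v k)\<bar> \<le> ((2 * (\<epsilon> * (s * N))) * N) / s"
      using elim by simp
    also have "\<dots> = e / 2" using elim N(1) by (simp add: \<epsilon>_def power2_eq_square)
    also have "\<dots> < e" using \<open>0 < e\<close> by simp
    finally show ?case by (simp add: dist_real_def)
  qed
qed

text \<open>The second difference is symmetric in the two directions, hence so is its limit.\<close>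

lemma hess_symmetric:
  fixes F :: "real^'n \<Rightarrow> real"
  assumes "open U" "x \<in> U" "\<And>z. z \<in> U \<Longrightarrow> F differentiable (at z)" "grad F differentiable (at x)"
  shows "h \<bullet> (hess F x *v k) = k \<bullet> (hess F x *v h)"
proof (rule tendsto_unique)
  let ?\<Delta> = "\<lambda>s. (F (x + s *\<^sub>R h + s *\<^sub>R k) - F (x + s *\<^sub>R h) - F (x + s *\<^sub>R k) + F x) / s\<^sup>2"
  show "(?\<Delta> \<longlongrightarrow> h \<bullet> (hess F x *v k)) (at_right 0)"
    by (rule second_difference_tendsto_hess[OF assms])
  have "?\<Delta> = (\<lambda>s. (F (x + s *\<^sub>R k + s *\<^sub>R h) - F (x + s *\<^sub>R k) - F (x + s *\<^sub>R h) + F x) / s\<^sup>2)"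
    by (simp add: add_ac fun_eq_iff)
  then show "(?\<Delta> \<longlongrightarrow> k \<bullet> (hess F x *v h)) (at_right 0)"
    using second_difference_tendsto_hess[OF assms, of k h] by simp
qed simp

section \<open>Dual norms of a positive definite form\<close>

lemma positive_definite_invertible:
  fixes M :: "real^'n^'n"
  assumes "\<And>h. h \<noteq> 0 \<Longrightarrow> 0 < h \<bullet> (M *v h)"
  shows "invertible M"
  unfolding invertible_left_inverse matrix_left_invertible_ker
  using assms by (metis inner_zero_right less_irrefl)

text \<open>Positivity of the form at $ah - bk$ with $a = k^T M k$ and $b = h^T M k$.\<close>

lemma symmetric_form_Cauchy_Schwarz:
  fixes M :: "real^'n^'n"
  assumes sym: "\<And>h k. h \<bullet> (M *v k) = k \<bullet> (M *v h)"
    and pos: "\<And>h. h \<noteq> 0 \<Longrightarrow> 0 < h \<bullet> (M *v h)"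
  shows "(h \<bullet> (M *v k))\<^sup>2 \<le> (h \<bullet> (M *v h)) * (k \<bullet> (M *v k))"
proof (cases "k = 0")
  case False
  define a b c where "a = k \<bullet> (M *v k)" and "b = h \<bullet> (M *v k)" and "c = h \<bullet> (M *v h)"
  have "0 < a" using pos[OF False] by (simp add: a_def)
  let ?w = "a *\<^sub>R h - b *\<^sub>R k"
  have "0 \<le> ?w \<bullet> (M *v ?w)" using pos[of ?w] by (cases "?w = 0") auto
  also have "\<dots> = a * (a * c - b\<^sup>2)"
    using sym[of k h]
    by (simp add: a_def b_def c_def algebra_simps power2_eq_square)
  finally show ?thesis using \<open>0 < a\<close> by (simp add: zero_le_mult_iff a_def b_def c_def mult_ac)
qed simp

text \<open>With $u = Mw$ this is the Cauchy--Schwarz inequality of the form \<open>M\<close> for \<open>w\<close> and \<open>v\<close>.\<close>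

lemma inner_le_dual_norm_mult_norm:
  fixes M :: "real^'n^'n"
  assumes sym: "\<And>h k. h \<bullet> (M *v k) = k \<bullet> (M *v h)"
    and pos: "\<And>h. h \<noteq> 0 \<Longrightarrow> 0 < h \<bullet> (M *v h)"
  shows "u \<bullet> v \<le> sqrt (u \<bullet> (matrix_inv M *v u)) * sqrt (v \<bullet> (M *v v))"
proof -
  have "M ** matrix_inv M = mat 1"
    using positive_definite_invertible[OF pos] someI_ex[of "\<lambda>A'. M ** A' = mat 1 \<and> A' ** M = mat 1"]
    unfolding invertible_def matrix_inv_def by auto
  define w where "w = matrix_inv M *v u"
  have u: "u = M *v w"
    by (simp add: w_def matrix_vector_mul_assoc \<open>M ** matrix_inv M = mat 1\<close>)
  have "u \<bullet> v = v \<bullet> (M *v w)" by (simp add: u inner_commute)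
  also have "\<dots> \<le> \<bar>v \<bullet> (M *v w)\<bar>" by simp
  also have "\<dots> \<le> sqrt ((v \<bullet> (M *v v)) * (w \<bullet> (M *v w)))"
    by (rule real_le_rsqrt) (simp add: symmetric_form_Cauchy_Schwarz[OF sym pos])
  also have "w \<bullet> (M *v w) = u \<bullet> w" by (simp add: u inner_commute)
  finally show ?thesis by (simp add: w_def real_sqrt_mult mult.commute)
qed

section \<open>Superdifferentials at interior points\<close>

lemma superdifferential_iff:
  "\<xi> \<in> superdifferential D \<phi> x \<longleftrightarrow> (\<forall>z\<in>D. \<phi> z \<le> \<phi> x + \<xi> \<bullet> (z - x))"
proof -
  have "\<xi> \<in> superdifferential D \<phi> x \<longleftrightarrow> - \<xi> \<in> subdifferential D (\<lambda>z. - \<phi> z) x"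
    unfolding superdifferential_def by (force simp: image_iff)
  then show ?thesis by (auto simp: subdifferential_def algebra_simps)
qed

text \<open>A hyperplane that supports the epigraph of \<open>- \<phi>\<close> at the point above \<open>x\<close> cannot be vertical,
  since \<open>x\<close> is interior to the domain; its slope is a supergradient up to sign.\<close>

lemma superdifferential_nonempty:
  fixes \<phi> :: "'a::euclidean_space \<Rightarrow> real"
  assumes "concave_on D \<phi>" "x \<in> interior D"
  shows "superdifferential D \<phi> x \<noteq> {}"
proof -
  define f where "f z = - \<phi> z" for z
  have f: "convex_on D f" using assms(1) by (simp add: concave_on_def f_def[abs_def])
  have xD: "x \<in> D" using assms(2) interior_subset by auto
  let ?E = "epigraph D f"
  have "convex ?E" using f by (rule convex_epigraphI)
  have "(x, f x) \<in> ?E" using xD by (simp add: mem_epigraph)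
  have "(x, f x) \<notin> rel_interior ?E"
  proof
    assume "(x, f x) \<in> rel_interior ?E"
    moreover have "(x, f x + 1) \<in> ?E" using xD by (simp add: mem_epigraph)
    ultimately obtain e where "e > 1" "(1 - e) *\<^sub>R (x, f x + 1) + e *\<^sub>R (x, f x) \<in> ?E"
      using convex_rel_interior_iff[OF \<open>convex ?E\<close>] by blast
    moreover have "(1 - e) *\<^sub>R (x, f x + 1) + e *\<^sub>R (x, f x) = (x, f x + (1 - e))"
      by (simp add: algebra_simps)
    ultimately show False by (simp add: mem_epigraph)
  qed
  then obtain p where p: "p \<noteq> 0" "\<And>y. y \<in> ?E \<Longrightarrow> p \<bullet> (x, f x) \<le> p \<bullet> y"
    using supporting_hyperplane_rel_boundary[OF \<open>convex ?E\<close> \<open>(x, f x) \<in> ?E\<close>] by metis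
  obtain a \<beta> where ab: "p = (a, \<beta>)" by (cases p)
  have sup: "a \<bullet> x + \<beta> * f x \<le> a \<bullet> z + \<beta> * r" if "z \<in> D" "f z \<le> r" for z r
    using p(2)[of "(z, r)"] that by (simp add: ab mem_epigraph)
  have "0 \<le> \<beta>" using sup[OF xD, of "f x + 1"] by (simp add: algebra_simps)
  have "\<beta> \<noteq> 0"
  proof
    assume "\<beta> = 0"
    obtain e where e: "0 < e" "ball x e \<subseteq> D" using assms(2) mem_interior by blast
    have "a \<noteq> 0" using p(1) ab \<open>\<beta> = 0\<close> by (simp add: zero_prod_def)
    let ?z = "x - (e / (2 * norm a)) *\<^sub>R a"
    have "?z \<in> D" using e \<open>a \<noteq> 0\<close> by (intro subsetD[OF e(2)]) (simp add: dist_norm)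
    from sup[OF this order_refl] \<open>\<beta> = 0\<close> have "(e / (2 * norm a)) * (a \<bullet> a) \<le> 0"
      by (simp add: inner_diff_right)
    moreover have "0 < (e / (2 * norm a)) * (a \<bullet> a)" using e(1) \<open>a \<noteq> 0\<close> by simp
    ultimately show False by simp
  qed
  with \<open>0 \<le> \<beta>\<close> have "0 < \<beta>" by simp
  have "\<phi> z \<le> \<phi> x + (a /\<^sub>R \<beta>) \<bullet> (z - x)" if "z \<in> D" for z
    using sup[OF that order_refl] \<open>0 < \<beta>\<close> by (simp add: f_def inner_diff_right field_simps)
  then have "a /\<^sub>R \<beta> \<in> superdifferential D \<phi> x" unfolding superdifferential_iff by blast
  then show ?thesis by blast
qed

text \<open>A supergradient bounds the decrease of \<open>\<phi>\<close> at distance \<open>e\<close> against its own direction from below by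
  \<open>e\<close> times its norm, while \<open>\<phi>\<close> is bounded on a compact ball around \<open>x\<close>.\<close>

lemma superdifferential_bounded:
  fixes \<phi> :: "'a::euclidean_space \<Rightarrow> real"
  assumes "concave_on D \<phi>" "x \<in> interior D"
  shows "bounded (superdifferential D \<phi> x)"
proof -
  obtain e where e: "0 < e" "cball x e \<subseteq> interior D"
    using assms(2) open_contains_cball[of "interior D"] by auto
  have "convex_on (interior D) (\<lambda>z. - \<phi> z)"
    using assms(1) unfolding concave_on_def
    by (meson convex_interior convex_on_imp_convex convex_on_subset interior_subset)
  then have "continuous_on (interior D) (\<lambda>z. - \<phi> z)"
    by (intro convex_on_continuous) auto
  then have "continuous_on (cball x e) (\<lambda>z. - \<phi> z)"
    using e(2) continuous_on_subset by blast
  moreover have "cball x e \<noteq> {}" using e(1) by simp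
  ultimately obtain w where w: "\<And>z. z \<in> cball x e \<Longrightarrow> - \<phi> z \<le> - \<phi> w"
    using continuous_attains_sup[OF compact_cball] by blast
  have "norm \<xi> \<le> (\<phi> x - \<phi> w) / e" if "\<xi> \<in> superdifferential D \<phi> x" for \<xi>
  proof (cases "\<xi> = 0")
    case True
    then show ?thesis using w[of x] e(1) by simp
  next
    case False
    let ?z = "x - (e / norm \<xi>) *\<^sub>R \<xi>"
    have z: "?z \<in> cball x e" using False e(1) by (simp add: dist_norm)
    then have "\<phi> ?z \<le> \<phi> x + \<xi> \<bullet> (?z - x)"
      using that e(2) interior_subset[of D] by (auto simp only: superdifferential_iff)
    also have "\<xi> \<bullet> (?z - x) = - (e * norm \<xi>)"
      using False by (simp add: power2_norm_eq_inner[symmetric] power2_eq_square)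
    finally have "e * norm \<xi> \<le> \<phi> x - \<phi> w" using w[OF z] by simp
    then show ?thesis using e(1) by (simp add: field_simps)
  qed
  then show ?thesis unfolding bounded_iff by blast
qed

section \<open>Self-concordant barriers on a bounded convex body\<close>

locale barrier_on_convex_body =
  fixes X :: "(real^'n) set" and F :: "real^'n \<Rightarrow> real" and \<nu> :: real
  assumes bounded: "bounded X" and closed: "closed X" and convex: "convex X"
    and interior_nonempty: "interior X \<noteq> {}"
    and barrier: "self_concordant_barrier F X \<nu>"
begin

lemma compact: "compact X"
  using bounded closed by (simp add: compact_eq_bounded_closed)

lemma convex_F: "convex_on (interior X) F"
  using barrier by (simp add: self_concordant_barrier_def)

lemma differentiable:
  assumes "x \<in> interior X"
  shows "F differentiable (at x)" "grad F differentiable (at x)" "hess F differentiable (at x)"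
  using barrier assms
  by (auto simp: self_concordant_barrier_def C3_on_def differentiable_on_eq_differentiable_at)

lemma continuous_F: "continuous_on (interior X) F"
  using convex_F by (intro convex_on_continuous) auto

lemma barrier_tendsto: "z \<in> frontier X \<Longrightarrow> filterlim F at_top (at z within interior X)"
  using barrier by (simp add: self_concordant_barrier_def)

lemma third_derivative_bound:
  "x \<in> interior X \<Longrightarrow> \<bar>D3 F x h\<bar> \<le> 2 * (h \<bullet> (hess F x *v h)) powr (3/2)"
  using barrier by (simp add: self_concordant_barrier_def)

lemma gradient_bound:
  "x \<in> interior X \<Longrightarrow> (grad F x \<bullet> h)\<^sup>2 \<le> \<nu> * (h \<bullet> (hess F x *v h))"
  using barrier by (simp add: self_concordant_barrier_def)

lemma DERIV_F_line:
  "x + s *\<^sub>R h \<in> interior X \<Longrightarrow>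
    ((\<lambda>s. F (x + s *\<^sub>R h)) has_real_derivative grad F (x + s *\<^sub>R h) \<bullet> h) (at s)"
  by (intro DERIV_along_line differentiable)

lemma DERIV_grad_line:
  "x + s *\<^sub>R h \<in> interior X \<Longrightarrow>
    ((\<lambda>s. grad F (x + s *\<^sub>R h) \<bullet> h) has_real_derivative
      h \<bullet> (hess F (x + s *\<^sub>R h) *v h)) (at s)"
  using DERIV_grad_along_line[of F x s h h] differentiable by (simp add: inner_commute)

lemma DERIV_hess_line:
  "x + s *\<^sub>R h \<in> interior X \<Longrightarrow>
    ((\<lambda>s. h \<bullet> (hess F (x + s *\<^sub>R h) *v h)) has_real_derivative D3 F (x + s *\<^sub>R h) h) (at s)"
  by (intro DERIV_hess_along_line differentiable)

lemma line_neighbourhood: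
  assumes "x \<in> interior X"
  obtains r where "0 < r" "\<And>s. \<bar>s\<bar> < r \<Longrightarrow> x + s *\<^sub>R h \<in> interior X"
proof -
  obtain e where e: "0 < e" "ball x e \<subseteq> interior X"
    using assms open_interior openE by blast
  have n: "0 < norm h + 1" by (simp add: add_nonneg_pos)
  show thesis
  proof (rule that[of "e / (norm h + 1)"])
    show "0 < e / (norm h + 1)" using e n by simp
    fix s assume "\<bar>s\<bar> < e / (norm h + 1)"
    then have "\<bar>s\<bar> * (norm h + 1) < e" using n by (simp add: field_simps)
    then have "norm (s *\<^sub>R h) < e" by (simp add: algebra_simps)
    then show "x + s *\<^sub>R h \<in> interior X" using e(2) by (auto simp: dist_norm)
  qed
qed

lemma segment_in_interior:
  assumes "x \<in> interior X" "z \<in> X" "0 \<le> s" "s < 1"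
  shows "x + s *\<^sub>R (z - x) \<in> interior X"
proof -
  have "z - (1 - s) *\<^sub>R (z - x) \<in> interior X"
    using assms by (intro mem_interior_convex_shrink[OF convex]) auto
  then show ?thesis by (simp add: algebra_simps)
qed

lemma segment_in_interior':
  assumes "x \<in> interior X" "z \<in> interior X" "0 \<le> s" "s \<le> 1"
  shows "x + s *\<^sub>R (z - x) \<in> interior X"
proof -
  have "(1 - s) *\<^sub>R x + s *\<^sub>R z \<in> interior X"
    using convexD_alt[OF convex_interior[OF convex]] assms by blast
  then show ?thesis by (simp add: algebra_simps)
qed

text \<open>A convex function lies above its tangents, so the slope along a line does not decrease.\<close>

lemma hess_nonneg:
  assumes "x \<in> interior X"
  shows "0 \<le> h \<bullet> (hess F x *v h)"
proof (rule ccontr)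
  assume neg: "\<not> ?thesis"
  obtain r where r: "0 < r" "\<And>s. \<bar>s\<bar> < r \<Longrightarrow> x + s *\<^sub>R h \<in> interior X"
    using line_neighbourhood[OF assms] by metis
  let ?p = "\<lambda>s. F (x + s *\<^sub>R h)" and ?p1 = "\<lambda>s. grad F (x + s *\<^sub>R h) \<bullet> h"
  have "convex_on {-r<..<r} ?p"
    unfolding convex_on_def
  proof (intro conjI ballI allI impI)
    fix a b u v :: real
    assume ab: "a \<in> {-r<..<r}" "b \<in> {-r<..<r}" and uv: "0 \<le> u" "0 \<le> v" "u + v = 1"
    have "x + (u *\<^sub>R a + v *\<^sub>R b) *\<^sub>R h = (u + v) *\<^sub>R x + (u *\<^sub>R a + v *\<^sub>R b) *\<^sub>R h"
      by (simp add: uv)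
    also have "\<dots> = u *\<^sub>R (x + a *\<^sub>R h) + v *\<^sub>R (x + b *\<^sub>R h)"
      by (simp add: algebra_simps)
    finally show "?p (u *\<^sub>R a + v *\<^sub>R b) \<le> u * ?p a + v * ?p b"
      using convex_F r(2)[of a] r(2)[of b] ab uv unfolding convex_on_def by auto
  qed simp
  then have tangent: "?p1 c * (s - c) \<le> ?p s - ?p c" if "\<bar>c\<bar> < r" "\<bar>s\<bar> < r" for c s
    using r(2)[OF that(1)] that
    by (intro convex_on_imp_above_tangent[of "{-r<..<r}" ?p])
      (auto intro!: has_field_derivative_at_within DERIV_F_line simp: abs_less_iff)
  have deriv: "DERIV ?p1 0 :> h \<bullet> (hess F (x + 0 *\<^sub>R h) *v h)"
    using assms by (intro DERIV_grad_line) simp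
  have "h \<bullet> (hess F (x + 0 *\<^sub>R h) *v h) < 0" using neg by simp
  from DERIV_neg_dec_right[OF deriv this]
  obtain d where d: "0 < d" "\<And>s. 0 < s \<Longrightarrow> s < d \<Longrightarrow> ?p1 (0 + s) < ?p1 0"
    by blast
  define s where "s = min d r / 2"
  have s: "0 < s" "s < d" "\<bar>s\<bar> < r" using d r by (auto simp: s_def)
  have "?p1 0 * s \<le> ?p s - ?p 0" using tangent[of 0 s] s r(1) by simp
  also have "\<dots> \<le> ?p1 s * s" using tangent[of s 0] s r(1) by simp
  finally have "?p1 0 * s \<le> ?p1 s * s" .
  then have "?p1 0 \<le> ?p1 s" using s by simp
  with d(2)[of s] s show False by simp
qed

text \<open>With a constant slope \<open>F\<close> would remain bounded on the way to the boundary, which every ray from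
  \<open>x\<close> reaches because \<open>X\<close> is bounded. This excludes degenerate Hessians and a zero parameter.\<close>

lemma gradient_not_constant_along_ray:
  assumes "x \<in> interior X" "h \<noteq> 0"
  obtains d where "0 < d" "\<And>s. 0 \<le> s \<Longrightarrow> s < d \<Longrightarrow> x + s *\<^sub>R h \<in> interior X"
    "\<And>c. \<exists>s. 0 \<le> s \<and> s < d \<and> grad F (x + s *\<^sub>R h) \<bullet> h \<noteq> c"
proof -
  obtain d where d: "0 < d" "x + d *\<^sub>R h \<in> frontier X"
    "\<And>s. 0 \<le> s \<Longrightarrow> s < d \<Longrightarrow> x + s *\<^sub>R h \<in> interior X"
    using ray_to_frontier[OF bounded assms] by metis
  have "\<forall>\<^sub>F s in at_left d. s \<in> {0<..<d}"
    using eventually_at_left_real[OF d(1)] .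
  then have "\<forall>\<^sub>F s in at_left d. x + s *\<^sub>R h \<in> interior X \<and> x + s *\<^sub>R h \<noteq> x + d *\<^sub>R h"
    by eventually_elim (use d(3) assms(2) in auto)
  moreover have "((\<lambda>s. x + s *\<^sub>R h) \<longlongrightarrow> x + d *\<^sub>R h) (at_left d)"
    by (intro tendsto_intros)
  ultimately have "filterlim (\<lambda>s. x + s *\<^sub>R h) (at (x + d *\<^sub>R h) within interior X) (at_left d)"
    by (simp add: filterlim_at)
  from filterlim_compose[OF barrier_tendsto[OF d(2)] this]
  have lim: "filterlim (\<lambda>s. F (x + s *\<^sub>R h)) at_top (at_left d)" .
  show thesis
  proof (rule that[OF d(1,3)])
    fix c
    show "\<exists>s. 0 \<le> s \<and> s < d \<and> grad F (x + s *\<^sub>R h) \<bullet> h \<noteq> c"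
    proof (rule ccontr)
      assume *: "\<not> ?thesis"
      have F_le: "F (x + s *\<^sub>R h) \<le> F x + \<bar>c\<bar> * d" if s: "0 < s" "s < d" for s
      proof -
        have "F (x + s *\<^sub>R h) - c * s \<le> F (x + 0 *\<^sub>R h) - c * 0"
        proof (rule DERIV_nonpos_imp_nonincreasing[of 0 s])
          fix u assume u: "0 \<le> u" "u \<le> s"
          have "((\<lambda>s. F (x + s *\<^sub>R h) - c * s) has_real_derivative
              grad F (x + u *\<^sub>R h) \<bullet> h - c * 1) (at u)"
            using u s by (intro DERIV_diff DERIV_F_line DERIV_cmult DERIV_ident d(3)) auto
          moreover have "grad F (x + u *\<^sub>R h) \<bullet> h - c * 1 \<le> 0"
            using * u s by (metis diff_self mult.right_neutral order_le_less_trans order_refl)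
          ultimately show "\<exists>y. ((\<lambda>s. F (x + s *\<^sub>R h) - c * s) has_real_derivative y) (at u) \<and> y \<le> 0"
            by blast
        qed (use s in simp)
        moreover have "c * s \<le> \<bar>c\<bar> * d" using s by (intro mult_mono) auto
        ultimately show ?thesis by simp
      qed
      have "\<forall>\<^sub>F s in at_left d. F x + \<bar>c\<bar> * d < F (x + s *\<^sub>R h)"
        using lim by (simp add: filterlim_at_top_dense)
      with \<open>\<forall>\<^sub>F s in at_left d. s \<in> {0<..<d}\<close> have "\<forall>\<^sub>F s in at_left d. False"
        by eventually_elim (use F_le in force)
      then show False by simp
    qed
  qed
qed

text \<open>If the curvature vanished at one point of a ray, it would vanish up to the boundary by
  self-concordance, and the slope would be constant.\<close>

lemma hess_pos:
  assumes "x \<in> interior X" "h \<noteq> 0"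
  shows "0 < h \<bullet> (hess F x *v h)"
proof (rule ccontr)
  assume "\<not> ?thesis"
  then have flat: "h \<bullet> (hess F x *v h) = 0" using hess_nonneg[OF assms(1), of h] by simp
  obtain d where d: "0 < d" "\<And>s. 0 \<le> s \<Longrightarrow> s < d \<Longrightarrow> x + s *\<^sub>R h \<in> interior X"
    "\<And>c. \<exists>s. 0 \<le> s \<and> s < d \<and> grad F (x + s *\<^sub>R h) \<bullet> h \<noteq> c"
    using gradient_not_constant_along_ray[OF assms] by blast
  have zero: "h \<bullet> (hess F (x + s *\<^sub>R h) *v h) = 0" if s: "0 \<le> s" "s < d" for s
  proof (rule self_concordant_flat_propagates[of s "\<lambda>s. h \<bullet> (hess F (x + s *\<^sub>R h) *v h)"])
    fix u assume "0 \<le> u" "u \<le> s"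
    then have u: "x + u *\<^sub>R h \<in> interior X" using s d(2) by auto
    show "((\<lambda>s. h \<bullet> (hess F (x + s *\<^sub>R h) *v h)) has_real_derivative D3 F (x + u *\<^sub>R h) h) (at u)"
      by (rule DERIV_hess_line[OF u])
    show "0 \<le> h \<bullet> (hess F (x + u *\<^sub>R h) *v h)" by (rule hess_nonneg[OF u])
    show "\<bar>D3 F (x + u *\<^sub>R h) h\<bar> \<le> 2 * (h \<bullet> (hess F (x + u *\<^sub>R h) *v h)) powr (3/2)"
      by (rule third_derivative_bound[OF u])
  qed (use s flat in auto)
  have "grad F (x + s *\<^sub>R h) \<bullet> h = grad F x \<bullet> h" if s: "0 \<le> s" "s < d" for s
  proof -
    have "grad F (x + s *\<^sub>R h) \<bullet> h = grad F (x + 0 *\<^sub>R h) \<bullet> h"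
    proof (cases "s = 0")
      case False
      show ?thesis
      proof (rule DERIV_isconst2[of 0 s])
        show "continuous_on {0..s} (\<lambda>s. grad F (x + s *\<^sub>R h) \<bullet> h)"
          using s by (intro continuous_at_imp_continuous_on ballI DERIV_isCont[OF DERIV_grad_line] d(2)) auto
        fix u assume "0 < u" "u < s"
        then show "((\<lambda>s. grad F (x + s *\<^sub>R h) \<bullet> h) has_real_derivative 0) (at u)"
          using DERIV_grad_line[of x u h] zero[of u] d(2)[of u] s by auto
      qed (use s False in auto)
    qed simp
    then show ?thesis by simp
  qed
  with d(3)[of "grad F x \<bullet> h"] show False by blast
qed

text \<open>With a nonpositive parameter the gradient would vanish along every ray.\<close>

lemma parameter_pos: "0 < \<nu>"
proof (rule ccontr)
  assume nu: "\<not> ?thesis"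
  obtain x where x: "x \<in> interior X" using interior_nonempty by auto
  define h :: "real^'n" where "h = axis undefined 1"
  have "h \<noteq> 0" by (simp add: h_def)
  obtain d where d: "0 < d" "\<And>s. 0 \<le> s \<Longrightarrow> s < d \<Longrightarrow> x + s *\<^sub>R h \<in> interior X"
    "\<And>c. \<exists>s. 0 \<le> s \<and> s < d \<and> grad F (x + s *\<^sub>R h) \<bullet> h \<noteq> c"
    using gradient_not_constant_along_ray[OF x \<open>h \<noteq> 0\<close>] by blast
  have "grad F (x + s *\<^sub>R h) \<bullet> h = 0" if "0 \<le> s" "s < d" for s
  proof -
    have "(grad F (x + s *\<^sub>R h) \<bullet> h)\<^sup>2 \<le> \<nu> * (h \<bullet> (hess F (x + s *\<^sub>R h) *v h))"
      by (rule gradient_bound[OF d(2)[OF that]])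
    also have "\<dots> \<le> 0"
      using nu hess_nonneg[OF d(2)[OF that], of h] by (simp add: mult_nonpos_nonneg)
    finally show ?thesis by simp
  qed
  with d(3)[of 0] show False by blast
qed

lemma hess_sym:
  assumes "x \<in> interior X"
  shows "h \<bullet> (hess F x *v k) = k \<bullet> (hess F x *v h)"
  by (rule hess_symmetric[OF open_interior assms differentiable(1) differentiable(2)[OF assms]])

lemma inner_le_local_norms:
  assumes "x \<in> interior X"
  shows "u \<bullet> v \<le> dual_local_norm F x u * local_norm F x v"
  unfolding dual_local_norm_def local_norm_def
  by (intro inner_le_dual_norm_mult_norm hess_sym hess_pos assms)

lemma local_norm_nonneg: "x \<in> interior X \<Longrightarrow> 0 \<le> local_norm F x h"
  by (simp add: local_norm_def hess_nonneg)

lemma dual_local_norm_nonneg: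
  assumes "x \<in> interior X"
  shows "0 \<le> dual_local_norm F x u"
proof (cases "u = 0")
  case False
  have "0 < u \<bullet> u" using False by simp
  also have "\<dots> \<le> dual_local_norm F x u * local_norm F x u"
    by (rule inner_le_local_norms[OF assms])
  finally show ?thesis
    using local_norm_nonneg[OF assms, of u] by (auto simp: zero_less_mult_iff)
qed (simp add: dual_local_norm_def)

abbreviation center :: "real^'n" where "center \<equiv> analytic_center F X"

lemma center_minimizes: "center \<in> interior X" "\<And>x. x \<in> interior X \<Longrightarrow> F center \<le> F x"
proof -
  have usc: "usc_on (interior X) (\<lambda>x. 0 + - F x)"
    by (rule usc_on_add_continuous) (auto simp: usc_on_def intro: continuous_on_minus continuous_F)
  obtain m where m: "m \<in> interior X" "\<And>x. x \<in> interior X \<Longrightarrow> - F x \<le> - F m"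
    using usc_on_interior_attains_max[OF compact interior_nonempty usc] barrier_tendsto
    by (auto simp: filterlim_uminus_at_top[symmetric])
  then have "is_arg_min F (\<lambda>x. x \<in> interior X) m" by (auto simp: is_arg_min_def not_less)
  then have "is_arg_min F (\<lambda>x. x \<in> interior X) center"
    unfolding analytic_center_def arg_min_on_def arg_min_def by (rule someI)
  then show "center \<in> interior X" "\<And>x. x \<in> interior X \<Longrightarrow> F center \<le> F x"
    by (auto simp: is_arg_min_def not_less)
qed

lemma grad_center: "grad F center \<bullet> h = 0"
proof -
  obtain r where r: "0 < r" "\<And>s. \<bar>s\<bar> < r \<Longrightarrow> center + s *\<^sub>R h \<in> interior X"
    using line_neighbourhood[OF center_minimizes(1)] by metis
  have "grad F (center + 0 *\<^sub>R h) \<bullet> h = 0"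
  proof (rule DERIV_local_min[of "\<lambda>s. F (center + s *\<^sub>R h)" _ 0 r])
    show "((\<lambda>s. F (center + s *\<^sub>R h)) has_real_derivative grad F (center + 0 *\<^sub>R h) \<bullet> h) (at 0)"
      using center_minimizes(1) by (intro DERIV_F_line) simp
  qed (use r center_minimizes(2) in auto)
  then show ?thesis by simp
qed

lemma growth_bound:
  assumes "x \<in> interior X" "z \<in> X" "0 \<le> s" "s < 1"
  shows "F (x + s *\<^sub>R (z - x)) \<le> F x - \<nu> * ln (1 - s)"
proof -
  let ?h = "z - x"
  have "F (x + s *\<^sub>R ?h) \<le> F (x + 0 *\<^sub>R ?h) - \<nu> * ln (1 - s)"
  proof (rule barrier_growth_bound[of s \<nu> "\<lambda>s. F (x + s *\<^sub>R ?h)"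
        "\<lambda>s. grad F (x + s *\<^sub>R ?h) \<bullet> ?h" "\<lambda>s. ?h \<bullet> (hess F (x + s *\<^sub>R ?h) *v ?h)"])
    fix u :: real assume "0 \<le> u" "u < 1"
    then have u: "x + u *\<^sub>R ?h \<in> interior X" by (rule segment_in_interior[OF assms(1,2)])
    show "((\<lambda>s. F (x + s *\<^sub>R ?h)) has_real_derivative grad F (x + u *\<^sub>R ?h) \<bullet> ?h) (at u)"
      by (rule DERIV_F_line[OF u])
    show "((\<lambda>s. grad F (x + s *\<^sub>R ?h) \<bullet> ?h) has_real_derivative
        ?h \<bullet> (hess F (x + u *\<^sub>R ?h) *v ?h)) (at u)"
      by (rule DERIV_grad_line[OF u])
    show "(grad F (x + u *\<^sub>R ?h) \<bullet> ?h)\<^sup>2 \<le> \<nu> * (?h \<bullet> (hess F (x + u *\<^sub>R ?h) *v ?h))"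
      by (rule gradient_bound[OF u])
  qed (use assms parameter_pos in auto)
  then show ?thesis by simp
qed

lemma omega_lower_bound:
  assumes "x \<in> interior X"
  shows "F center + omega (local_norm F center (x - center)) \<le> F x"
proof (cases "x = center")
  case False
  let ?h = "x - center"
  note seg = segment_in_interior'[OF center_minimizes(1) assms]
  have "F (center + 0 *\<^sub>R ?h) + 1 * (grad F (center + 0 *\<^sub>R ?h) \<bullet> ?h)
      + omega (1 * sqrt (?h \<bullet> (hess F (center + 0 *\<^sub>R ?h) *v ?h))) \<le> F (center + 1 *\<^sub>R ?h)"
  proof (rule self_concordant_lower_bound[of 1 "\<lambda>s. F (center + s *\<^sub>R ?h)"
        "\<lambda>s. grad F (center + s *\<^sub>R ?h) \<bullet> ?h"
        "\<lambda>s. ?h \<bullet> (hess F (center + s *\<^sub>R ?h) *v ?h)"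
        "\<lambda>s. D3 F (center + s *\<^sub>R ?h) ?h"])
    fix u :: real assume "0 \<le> u" "u \<le> 1"
    then have u: "center + u *\<^sub>R ?h \<in> interior X" by (rule seg)
    show "((\<lambda>s. F (center + s *\<^sub>R ?h)) has_real_derivative grad F (center + u *\<^sub>R ?h) \<bullet> ?h) (at u)"
      by (rule DERIV_F_line[OF u])
    show "((\<lambda>s. grad F (center + s *\<^sub>R ?h) \<bullet> ?h) has_real_derivative
        ?h \<bullet> (hess F (center + u *\<^sub>R ?h) *v ?h)) (at u)"
      by (rule DERIV_grad_line[OF u])
    show "((\<lambda>s. ?h \<bullet> (hess F (center + s *\<^sub>R ?h) *v ?h)) has_real_derivative
        D3 F (center + u *\<^sub>R ?h) ?h) (at u)"
      by (rule DERIV_hess_line[OF u])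
    show "0 < ?h \<bullet> (hess F (center + u *\<^sub>R ?h) *v ?h)"
      by (rule hess_pos[OF u]) (use False in simp)
    show "\<bar>D3 F (center + u *\<^sub>R ?h) ?h\<bar> \<le> 2 * (?h \<bullet> (hess F (center + u *\<^sub>R ?h) *v ?h)) powr (3/2)"
      by (rule third_derivative_bound[OF u])
  qed simp
  then show ?thesis using grad_center by (simp add: local_norm_def)
qed (simp add: local_norm_def omega_def)

text \<open>Let \<open>h = z - center\<close>, let \<open>r\<close> be its local norm, and suppose $r > \sqrt\nu$. At the point at
  local distance $\sqrt\nu$ from the center on the segment to \<open>z\<close>, self-concordance and the
  vanishing gradient at the center bound the slope from below by $r\sqrt\nu/(1+\sqrt\nu)$, whereas
  the barrier inequality bounds it from above by $\nu/(1-\sqrt\nu/r)$, because the segment continues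
  inside \<open>X\<close> up to \<open>z\<close>. Comparison gives the bound on \<open>r\<close>.\<close>

lemma body_within_local_radius:
  assumes "z \<in> X"
  shows "local_norm F center (z - center) \<le> \<nu> + 2 * sqrt \<nu>"
proof -
  define h r q where "h = z - center" and "r = local_norm F center h" and "q = sqrt \<nu>"
  have q: "0 < q" "\<nu> = q * q" using parameter_pos by (auto simp: q_def)
  have "r \<le> \<nu> + 2 * q"
  proof (cases "r \<le> q")
    case True
    then show ?thesis using parameter_pos q(1) by linarith
  next
    case False
    then have "q < r" "0 < r" using q by auto
    have "h \<noteq> 0" using \<open>0 < r\<close> by (auto simp: r_def local_norm_def)
    have rr: "h \<bullet> (hess F center *v h) = r * r"
      using hess_nonneg[OF center_minimizes(1)] by (simp add: r_def local_norm_def)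
    \<comment> \<open>The parameter of the point at local distance \<open>sqrt \<nu>\<close> from the center.\<close>
    define \<alpha> where "\<alpha> = q / r"
    have \<alpha>: "0 < \<alpha>" "\<alpha> < 1" "\<alpha> * r = q" using \<open>q < r\<close> \<open>0 < r\<close> q by (auto simp: \<alpha>_def)
    have seg: "center + s *\<^sub>R h \<in> interior X" if "0 \<le> s" "s < 1" for s
      using segment_in_interior[OF center_minimizes(1) assms that] by (simp add: h_def)
    have seg': "center + s *\<^sub>R h \<in> interior X" if "0 \<le> s" "s \<le> \<alpha>" for s
      using seg[of s] that \<alpha> by simp
    let ?p1 = "\<lambda>s. grad F (center + s *\<^sub>R h) \<bullet> h"
    have "?p1 0 + \<alpha> * (h \<bullet> (hess F (center + 0 *\<^sub>R h) *v h)) /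
        (1 + \<alpha> * sqrt (h \<bullet> (hess F (center + 0 *\<^sub>R h) *v h))) \<le> ?p1 \<alpha>"
    proof (rule self_concordant_slope_bound[of \<alpha> ?p1 "\<lambda>s. h \<bullet> (hess F (center + s *\<^sub>R h) *v h)"
            "\<lambda>s. D3 F (center + s *\<^sub>R h) h"])
      fix u assume "0 \<le> u" "u \<le> \<alpha>"
      then have u: "center + u *\<^sub>R h \<in> interior X" by (rule seg')
      show "(?p1 has_real_derivative h \<bullet> (hess F (center + u *\<^sub>R h) *v h)) (at u)"
        by (rule DERIV_grad_line[OF u])
      show "((\<lambda>s. h \<bullet> (hess F (center + s *\<^sub>R h) *v h)) has_real_derivative
          D3 F (center + u *\<^sub>R h) h) (at u)"
        by (rule DERIV_hess_line[OF u])
      show "0 < h \<bullet> (hess F (center + u *\<^sub>R h) *v h)"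
        by (rule hess_pos[OF u \<open>h \<noteq> 0\<close>])
      show "\<bar>D3 F (center + u *\<^sub>R h) h\<bar> \<le> 2 * (h \<bullet> (hess F (center + u *\<^sub>R h) *v h)) powr (3/2)"
        by (rule third_derivative_bound[OF u])
    qed (use \<alpha> in simp)
    then have "q * r / (1 + q) \<le> ?p1 \<alpha>"
      using \<alpha> \<open>0 < r\<close> by (simp add: grad_center rr mult.assoc[symmetric])
    moreover have "?p1 \<alpha> * (1 - \<alpha>) \<le> \<nu>"
    proof (rule barrier_slope_bound[of \<alpha> 1 \<nu> ?p1 "\<lambda>s. h \<bullet> (hess F (center + s *\<^sub>R h) *v h)"])
      fix u assume "\<alpha> \<le> u" "u < 1"
      then have u: "center + u *\<^sub>R h \<in> interior X" using \<alpha>(1) seg by simp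
      show "(?p1 has_real_derivative h \<bullet> (hess F (center + u *\<^sub>R h) *v h)) (at u)"
        by (rule DERIV_grad_line[OF u])
      show "(?p1 u)\<^sup>2 \<le> \<nu> * (h \<bullet> (hess F (center + u *\<^sub>R h) *v h))"
        by (rule gradient_bound[OF u])
    qed (use \<alpha> parameter_pos in auto)
    moreover have "q * r / (1 + q) * (1 - \<alpha>) \<le> ?p1 \<alpha> * (1 - \<alpha>)"
      using calculation(1) \<alpha>(2) by (intro mult_right_mono) auto
    ultimately have "q * r / (1 + q) * (1 - \<alpha>) \<le> q * q"
      using q(2) by linarith
    then have "q * r * (1 - \<alpha>) \<le> q * q * (1 + q)" using q(1) by (simp add: field_simps)
    then have "q * (r - q) \<le> q * (q * (1 + q))"
      using \<alpha>(3) by (simp add: algebra_simps)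
    then have "r - q \<le> q * (1 + q)" using q(1) by simp
    then show ?thesis using q(2) by (simp add: algebra_simps)
  qed
  then show ?thesis by (simp add: h_def r_def q_def)
qed

end

section \<open>The smoothing gap of one block\<close>

lemma SUP_eq_at_maximum:
  fixes f :: "'a \<Rightarrow> real"
  assumes "m \<in> S" "\<And>x. x \<in> S \<Longrightarrow> f x \<le> f m"
  shows "(SUP x\<in>S. f x) = f m"
  by (rule cSup_eq_maximum) (use assms in auto)

lemma le_zeta_bar:
  assumes "0 < a"
  shows "a \<le> zeta_bar \<tau> a c"
  using assms by (auto simp: zeta_bar_def max_def distrib_left)

text \<open>Together with the preceding lemma this covers both branches of the maximum in
  \<^const>\<open>zeta_bar\<close>.\<close>

lemma ln_le_zeta_bar:
  assumes "0 < a" "0 < c" "0 < \<delta>" "\<delta> \<le> \<tau>"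
  shows "a * (1 + ln (\<delta> / (a * c))) \<le> zeta_bar \<tau> a c"
proof -
  have "ln (\<delta> / (a * c)) \<le> ln (\<tau> / (a * c))"
    using assms by (simp add: divide_right_mono)
  moreover have "\<tau> / (a * c) \<noteq> 0" using assms by simp
  ultimately show ?thesis using assms(1) by (simp add: zeta_bar_def)
qed

text \<open>One of the two blocks of the problem. The dual functions split into block terms, so each block is
  treated alone and the locale is interpreted twice at the end.\<close>

locale smoothed_block = barrier_on_convex_body X F \<nu>
  for X :: "(real^'n) set" and F :: "real^'n \<Rightarrow> real" and \<nu> :: real +
  fixes D :: "(real^'n) set" and \<phi> :: "real^'n \<Rightarrow> real"
    and A :: "real^'n^'m" and t :: real
  assumes concave: "concave_on D \<phi>" and X_subset_D: "X \<subseteq> D" and usc: "usc_on X \<phi>"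
    and t_pos: "0 < t"
begin

abbreviation lagrangian :: "real^'m \<Rightarrow> real^'n \<Rightarrow> real" where
  "lagrangian y x \<equiv> \<phi> x + y \<bullet> (A *v x)"

lemma usc_lagrangian: "usc_on X (lagrangian y)"
  by (rule usc_on_add_continuous[OF usc])
    (intro continuous_intros linear_continuous_on matrix_vector_mul_bounded_linear)

lemma lagrangian_maximizer:
  obtains m where "m \<in> X" "\<And>x. x \<in> X \<Longrightarrow> lagrangian y x \<le> lagrangian y m"
  using usc_on_attains_max[OF compact _ usc_lagrangian] interior_nonempty interior_subset
  by (metis subset_empty)

lemma smoothed_obj_eq:
  "smoothed_obj \<phi> F X A y t = (\<lambda>x. lagrangian y x + - (t * (F x - F center)))"
  by (simp add: smoothed_obj_def fun_eq_iff)

lemma smoothed_obj_coercive: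
  assumes "z \<in> frontier X"
  shows "filterlim (smoothed_obj \<phi> F X A y t) at_bot (at z within interior X)"
proof -
  obtain m where m: "\<And>x. x \<in> X \<Longrightarrow> lagrangian y x \<le> lagrangian y m"
    using lagrangian_maximizer by metis
  show ?thesis
    unfolding filterlim_at_bot
  proof
    fix c
    have "\<forall>\<^sub>F x in at z within interior X. F center + (lagrangian y m - c) / t \<le> F x"
      using barrier_tendsto[OF assms] by (simp add: filterlim_at_top)
    moreover have "\<forall>\<^sub>F x in at z within interior X. x \<in> interior X"
      by (simp add: eventually_at_filter)
    ultimately show "\<forall>\<^sub>F x in at z within interior X. smoothed_obj \<phi> F X A y t x \<le> c"
    proof eventually_elim
      case (elim x)
      then have "lagrangian y m - c \<le> t * (F x - F center)"
        using t_pos by (simp add: field_simps)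
      moreover have "lagrangian y x \<le> lagrangian y m"
        using elim interior_subset by (intro m) auto
      ultimately show ?case by (simp add: smoothed_obj_eq)
    qed
  qed
qed

abbreviation smoothed_maximizer :: "real^'m \<Rightarrow> real^'n" where
  "smoothed_maximizer y \<equiv> smoothed_argmax \<phi> F X A y t"

lemma smoothed_maximizer:
  "smoothed_maximizer y \<in> interior X"
  "\<And>x. x \<in> interior X \<Longrightarrow>
    smoothed_obj \<phi> F X A y t x \<le> smoothed_obj \<phi> F X A y t (smoothed_maximizer y)"
proof -
  have "usc_on (interior X) (smoothed_obj \<phi> F X A y t)"
    unfolding smoothed_obj_eq
    by (rule usc_on_add_continuous[OF usc_on_subset[OF usc_lagrangian interior_subset]])
      (intro continuous_intros continuous_F)
  then obtain m where m: "m \<in> interior X"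
    "\<And>x. x \<in> interior X \<Longrightarrow> smoothed_obj \<phi> F X A y t x \<le> smoothed_obj \<phi> F X A y t m"
    using usc_on_interior_attains_max[OF compact interior_nonempty _ smoothed_obj_coercive]
    by metis
  then have "is_arg_max (smoothed_obj \<phi> F X A y t) (\<lambda>x. x \<in> interior X) m"
    by (auto simp: is_arg_max_def not_less)
  then have "is_arg_max (smoothed_obj \<phi> F X A y t) (\<lambda>x. x \<in> interior X) (smoothed_maximizer y)"
    unfolding smoothed_argmax_def arg_max_on_def arg_max_def by (rule someI)
  then show "smoothed_maximizer y \<in> interior X"
    "\<And>x. x \<in> interior X \<Longrightarrow>
      smoothed_obj \<phi> F X A y t x \<le> smoothed_obj \<phi> F X A y t (smoothed_maximizer y)"
    by (auto simp: is_arg_max_def not_less)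
qed

lemma smoothed_max_eq:
  "smoothed_max \<phi> F X A y t = smoothed_obj \<phi> F X A y t (smoothed_maximizer y)"
  unfolding smoothed_max_def by (rule SUP_eq_at_maximum) (use smoothed_maximizer in auto)

text \<open>The smoothed maximum differs from a value of the Lagrangian by the barrier term at its maximizer,
  and the barrier term dominates \<^const>\<open>omega\<close> of the distance to the center.\<close>

lemma smoothing_gap_lower_bound:
  assumes "\<And>x. x \<in> X \<Longrightarrow> lagrangian y x \<le> lagrangian y m"
  shows "t * omega (local_norm F center (smoothed_maximizer y - center))
    \<le> lagrangian y m - smoothed_max \<phi> F X A y t"
proof -
  let ?x = "smoothed_maximizer y"
  have "omega (local_norm F center (?x - center)) \<le> F ?x - F center"
    using omega_lower_bound[OF smoothed_maximizer(1), of y] by simp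
  then have "t * omega (local_norm F center (?x - center)) \<le> t * (F ?x - F center)"
    using t_pos by simp
  moreover have "lagrangian y ?x \<le> lagrangian y m"
    using smoothed_maximizer(1)[of y] interior_subset by (intro assms) auto
  ultimately show ?thesis by (simp add: smoothed_max_eq smoothed_obj_eq)
qed

lemma lagrangian_concave_on_segment:
  assumes "x \<in> X" "z \<in> X" "0 \<le> s" "s \<le> 1"
  shows "(1 - s) * lagrangian y x + s * lagrangian y z \<le> lagrangian y (x + s *\<^sub>R (z - x))"
proof -
  have eq: "x + s *\<^sub>R (z - x) = (1 - s) *\<^sub>R x + s *\<^sub>R z" by (simp add: algebra_simps)
  have "(1 - s) * \<phi> x + s * \<phi> z \<le> \<phi> ((1 - s) *\<^sub>R x + s *\<^sub>R z)"
    using concave assms X_subset_D unfolding concave_on_iff by (auto simp: subset_iff)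
  then show ?thesis
    unfolding eq by (simp add: matrix_vector_right_distrib matrix_vector_mult_scaleR
        inner_add_right distrib_left)
qed

text \<open>The smoothed objective is tested at the point that divides the segment from the center to the
  unsmoothed maximizer, leaving the fraction \<open>\<tau>\<close>. Concavity loses at most \<open>\<tau>\<close> times the gain
  over the center, and the barrier costs at most $-t\nu\ln\tau$.\<close>

lemma smoothing_gap_le:
  assumes "m \<in> X" "0 < \<tau>" "\<tau> \<le> 1"
  shows "lagrangian y m - smoothed_max \<phi> F X A y t
    \<le> \<tau> * (lagrangian y m - lagrangian y center) - t * \<nu> * ln \<tau>"
proof -
  define s where "s = 1 - \<tau>"
  have s: "0 \<le> s" "s < 1" "s \<le> 1" "\<tau> = 1 - s" using assms by (auto simp: s_def)
  let ?x = "center + s *\<^sub>R (m - center)"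
  have cX: "center \<in> X" using center_minimizes(1) interior_subset by auto
  have "F ?x \<le> F center - \<nu> * ln \<tau>"
    using growth_bound[OF center_minimizes(1) assms(1) s(1,2)] s(4) by simp
  then have "t * (F ?x - F center) \<le> t * (- \<nu> * ln \<tau>)"
    using t_pos by (intro mult_left_mono) auto
  moreover have "smoothed_obj \<phi> F X A y t ?x \<le> smoothed_max \<phi> F X A y t"
    unfolding smoothed_max_eq
    by (rule smoothed_maximizer(2)[OF segment_in_interior[OF center_minimizes(1) assms(1) s(1,2)]])
  moreover note lagrangian_concave_on_segment[OF cX assms(1) s(1,3), of y]
  ultimately show ?thesis by (simp add: smoothed_obj_eq s(4) algebra_simps)
qed

text \<open>Both suprema in \<^const>\<open>K_const\<close> are over bounded sets of numbers, because the superdifferential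
  at the center and \<open>Y\<close> are bounded and the dual norm is continuous.\<close>

lemma dual_norm_le_K_const:
  assumes "bounded Y" "y \<in> Y" "\<xi> \<in> superdifferential D \<phi> center"
  shows "(\<nu> + 2 * sqrt \<nu>) * dual_local_norm F center (\<xi> + transpose A *v y)
    \<le> K_const D \<phi> F X \<nu> A Y"
proof -
  let ?S = "superdifferential D \<phi> center"
  let ?U = "\<Union>\<xi>\<in>?S. \<Union>v\<in>(*v) (transpose A) ` Y. {\<xi> + v}"
  let ?f = "dual_local_norm F center"
  let ?g = "\<lambda>y. SUP \<xi>\<in>?S. ?f (\<xi> + transpose A *v y)"
  have "center \<in> interior D"
    using center_minimizes(1) interior_mono[OF X_subset_D] by auto
  then have S: "bounded ?S" by (rule superdifferential_bounded[OF concave])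
  have "bounded ?U"
    by (intro bounded_sums S bounded_linear_image assms(1) matrix_vector_mul_bounded_linear)
  then have "compact (closure ?U)" by simp
  moreover have "continuous_on (closure ?U) ?f"
    unfolding dual_local_norm_def
    by (intro continuous_intros linear_continuous_on matrix_vector_mul_bounded_linear)
  ultimately have "bounded (?f ` closure ?U)"
    by (intro compact_imp_bounded compact_continuous_image)
  then obtain B where B: "\<And>u. u \<in> closure ?U \<Longrightarrow> \<bar>?f u\<bar> \<le> B"
    unfolding bounded_iff by auto
  have le_B: "?f (\<zeta> + transpose A *v z) \<le> B" if "\<zeta> \<in> ?S" "z \<in> Y" for \<zeta> z
  proof -
    have "\<zeta> + transpose A *v z \<in> ?U" using that by blast
    then have "\<zeta> + transpose A *v z \<in> closure ?U" using closure_subset by (rule rev_subsetD)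
    from B[OF this] show ?thesis by linarith
  qed
  have "?f (\<xi> + transpose A *v y) \<le> ?g y"
    by (rule cSUP_upper[OF assms(3)]) (use le_B assms(2) in \<open>auto intro!: bdd_aboveI2[of _ _ B]\<close>)
  also have "?g y \<le> (SUP y\<in>Y. ?g y)"
  proof (rule cSUP_upper[OF assms(2)])
    have "?g z \<le> B" if "z \<in> Y" for z
      by (rule cSUP_least) (use le_B that assms(3) in auto)
    then show "bdd_above (?g ` Y)" by (rule bdd_aboveI2)
  qed
  finally show ?thesis
    using parameter_pos unfolding K_const_def Let_def by (intro mult_left_mono) auto
qed

text \<open>The gain is at most the pairing of a supergradient of the Lagrangian at the center with
  \<open>m - center\<close>; the dual norms split the pairing, and the radius of \<open>X\<close> around the center is known.\<close>

lemma lagrangian_gain_le_K_const: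
  assumes "bounded Y" "y \<in> Y" "m \<in> X"
  shows "lagrangian y m - lagrangian y center \<le> K_const D \<phi> F X \<nu> A Y"
proof -
  have "center \<in> interior D"
    using center_minimizes(1) interior_mono[OF X_subset_D] by auto
  then obtain \<xi> where \<xi>: "\<xi> \<in> superdifferential D \<phi> center"
    using superdifferential_nonempty[OF concave] by blast
  let ?u = "\<xi> + transpose A *v y" and ?v = "m - center"
  have "\<phi> m \<le> \<phi> center + \<xi> \<bullet> ?v"
    using \<xi> assms(3) X_subset_D by (auto simp: superdifferential_iff)
  then have "lagrangian y m - lagrangian y center \<le> ?u \<bullet> ?v"
    by (simp add: algebra_simps dot_lmul_matrix)
  also have "\<dots> \<le> dual_local_norm F center ?u * local_norm F center ?v"
    by (rule inner_le_local_norms[OF center_minimizes(1)])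
  also have "\<dots> \<le> dual_local_norm F center ?u * (\<nu> + 2 * sqrt \<nu>)"
    using body_within_local_radius[OF assms(3)] dual_local_norm_nonneg[OF center_minimizes(1)]
    by (rule mult_left_mono)
  also have "\<dots> \<le> K_const D \<phi> F X \<nu> A Y"
    using dual_norm_le_K_const[OF assms(1,2) \<xi>] by (simp add: mult.commute)
  finally show ?thesis .
qed

text \<open>Let \<open>\<delta>\<close> be the gain over the center. The bound $\tau\delta - t\nu\ln\tau$ is minimal on
  $(0,1]$ at $\tau = \min\{1, t\nu/\delta\}$; its value there is at most $t\nu$ in the first case and
  equals $t\nu(1 + \ln(\delta/(t\nu)))$ in the second.\<close>

lemma smoothing_gap_upper_bound:
  assumes "bounded Y" "y \<in> Y" "m \<in> X"
  shows "lagrangian y m - smoothed_max \<phi> F X A y t \<le> t * zeta_bar (K_const D \<phi> F X \<nu> A Y) \<nu> t"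
proof -
  let ?K = "K_const D \<phi> F X \<nu> A Y"
  define \<delta> where "\<delta> = lagrangian y m - lagrangian y center"
  have \<delta>K: "\<delta> \<le> ?K"
    unfolding \<delta>_def by (rule lagrangian_gain_le_K_const[OF assms])
  note gap = smoothing_gap_le[OF assms(3), of _ y, folded \<delta>_def]
  have tn: "0 < t * \<nu>" using t_pos parameter_pos by simp
  show ?thesis
  proof (cases "\<delta> \<le> t * \<nu>")
    case True
    have "lagrangian y m - smoothed_max \<phi> F X A y t \<le> t * \<nu>"
      using gap[of 1] True by simp
    also have "\<dots> \<le> t * zeta_bar ?K \<nu> t"
      using le_zeta_bar[OF parameter_pos] t_pos by (intro mult_left_mono) auto
    finally show ?thesis .
  next
    case False
    then have "0 < \<delta>" using tn by simp
    have "lagrangian y m - smoothed_max \<phi> F X A y t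
        \<le> (t * \<nu> / \<delta>) * \<delta> - t * \<nu> * ln (t * \<nu> / \<delta>)"
      using False tn \<open>0 < \<delta>\<close> by (intro gap) auto
    also have "\<dots> = t * (\<nu> * (1 + ln (\<delta> / (\<nu> * t))))"
      using tn t_pos parameter_pos \<open>0 < \<delta>\<close> by (simp add: ln_div ln_mult algebra_simps)
    also have "\<dots> \<le> t * zeta_bar ?K \<nu> t"
      using ln_le_zeta_bar[OF parameter_pos t_pos \<open>0 < \<delta>\<close> \<delta>K] t_pos
      by (intro mult_left_mono) auto
    finally show ?thesis .
  qed
qed

end

section \<open>The smoothing gap of the dual function\<close>

lemma dual_fun_eq_at_maximizers:
  fixes A1 :: "real^'n1^'m" and A2 :: "real^'n2^'m"
  assumes "m1 \<in> X1" "\<And>x. x \<in> X1 \<Longrightarrow> \<phi>1 x + y \<bullet> (A1 *v x) \<le> \<phi>1 m1 + y \<bullet> (A1 *v m1)"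
    and "m2 \<in> X2" "\<And>x. x \<in> X2 \<Longrightarrow> \<phi>2 x + y \<bullet> (A2 *v x) \<le> \<phi>2 m2 + y \<bullet> (A2 *v m2)"
  shows "dual_fun \<phi>1 \<phi>2 X1 X2 A1 A2 b y =
    (\<phi>1 m1 + y \<bullet> (A1 *v m1)) + (\<phi>2 m2 + y \<bullet> (A2 *v m2)) - b \<bullet> y"
proof -
  have "dual_fun \<phi>1 \<phi>2 X1 X2 A1 A2 b y =
      \<phi>1 (fst (m1, m2)) + \<phi>2 (snd (m1, m2)) + y \<bullet> (A1 *v fst (m1, m2) + A2 *v snd (m1, m2) - b)"
    unfolding dual_fun_def
  proof (rule SUP_eq_at_maximum)
    fix x assume "x \<in> X1 \<times> X2"
    then show "\<phi>1 (fst x) + \<phi>2 (snd x) + y \<bullet> (A1 *v fst x + A2 *v snd x - b)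
        \<le> \<phi>1 (fst (m1, m2)) + \<phi>2 (snd (m1, m2)) + y \<bullet> (A1 *v fst (m1, m2) + A2 *v snd (m1, m2) - b)"
      using assms(2)[of "fst x"] assms(4)[of "snd x"]
      by (auto simp: inner_add_right inner_diff_right)
  qed (use assms in auto)
  then show ?thesis by (simp add: inner_add_right inner_diff_right inner_commute)
qed

theorem lemma3p2:
  fixes X1 D1 :: "(real^'n1) set" and X2 D2 :: "(real^'n2) set"
    and F1 \<phi>1 :: "real^'n1 \<Rightarrow> real" and F2 \<phi>2 :: "real^'n2 \<Rightarrow> real"
    and \<nu>1 \<nu>2 t :: real
    and A1 :: "real^'n1^'m" and A2 :: "real^'n2^'m" and b y :: "real^'m"
    and Y :: "(real^'m) set"
  assumes "bounded X1" "closed X1" "convex X1" "interior X1 \<noteq> {}"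
    and "bounded X2" "closed X2" "convex X2" "interior X2 \<noteq> {}"
    and "self_concordant_barrier F1 X1 \<nu>1" "self_concordant_barrier F2 X2 \<nu>2"
    and "concave_on D1 \<phi>1" "X1 \<subseteq> D1" "usc_on X1 \<phi>1"
    and "concave_on D2 \<phi>2" "X2 \<subseteq> D2" "usc_on X2 \<phi>2"
    and "rank (block_row A1 A2) = CARD('m)"
    and "primal_solutions \<phi>1 \<phi>2 X1 X2 A1 A2 b \<noteq> {}"
    and "rel_interior (X1 \<times> X2) \<inter> feasible_plane A1 A2 b \<noteq> {} \<or> polyhedron (X1 \<times> X2)"
    and "bounded Y" "dual_minimizers \<phi>1 \<phi>2 X1 X2 A1 A2 b \<subseteq> Y"
    and "t > 0" "y \<in> Y"
  shows "0 \<le> t * (omega (local_norm F1 (analytic_center F1 X1)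
                    (smoothed_argmax \<phi>1 F1 X1 A1 y t - analytic_center F1 X1))
                + omega (local_norm F2 (analytic_center F2 X2)
                    (smoothed_argmax \<phi>2 F2 X2 A2 y t - analytic_center F2 X2)))
       \<and> t * (omega (local_norm F1 (analytic_center F1 X1)
                    (smoothed_argmax \<phi>1 F1 X1 A1 y t - analytic_center F1 X1))
                + omega (local_norm F2 (analytic_center F2 X2)
                    (smoothed_argmax \<phi>2 F2 X2 A2 y t - analytic_center F2 X2)))
           \<le> dual_fun \<phi>1 \<phi>2 X1 X2 A1 A2 b y - smoothed_dual_fun \<phi>1 \<phi>2 F1 F2 X1 X2 A1 A2 b y t
       \<and> dual_fun \<phi>1 \<phi>2 X1 X2 A1 A2 b y - smoothed_dual_fun \<phi>1 \<phi>2 F1 F2 X1 X2 A1 A2 b y t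
           \<le> t * (zeta_bar (K_const D1 \<phi>1 F1 X1 \<nu>1 A1 Y) \<nu>1 t
                + zeta_bar (K_const D2 \<phi>2 F2 X2 \<nu>2 A2 Y) \<nu>2 t)"
proof -
  interpret B1: smoothed_block X1 F1 \<nu>1 D1 \<phi>1 A1 t
    by unfold_locales (use assms in auto)
  interpret B2: smoothed_block X2 F2 \<nu>2 D2 \<phi>2 A2 t
    by unfold_locales (use assms in auto)
  obtain m1 where m1: "m1 \<in> X1" "\<And>x. x \<in> X1 \<Longrightarrow> B1.lagrangian y x \<le> B1.lagrangian y m1"
    using B1.lagrangian_maximizer by blast
  obtain m2 where m2: "m2 \<in> X2" "\<And>x. x \<in> X2 \<Longrightarrow> B2.lagrangian y x \<le> B2.lagrangian y m2"
    using B2.lagrangian_maximizer by blast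
  let ?w1 = "omega (local_norm F1 B1.center (B1.smoothed_maximizer y - B1.center))"
  let ?w2 = "omega (local_norm F2 B2.center (B2.smoothed_maximizer y - B2.center))"
  let ?gap = "dual_fun \<phi>1 \<phi>2 X1 X2 A1 A2 b y - smoothed_dual_fun \<phi>1 \<phi>2 F1 F2 X1 X2 A1 A2 b y t"
  have gap: "?gap = (B1.lagrangian y m1 - smoothed_max \<phi>1 F1 X1 A1 y t)
      + (B2.lagrangian y m2 - smoothed_max \<phi>2 F2 X2 A2 y t)"
    using dual_fun_eq_at_maximizers[OF m1 m2, of b] by (simp add: smoothed_dual_fun_def)
  have "0 \<le> ?w1" "0 \<le> ?w2"
    using omega_nonneg B1.local_norm_nonneg[OF B1.center_minimizes(1)]
      B2.local_norm_nonneg[OF B2.center_minimizes(1)] by auto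
  then have "0 \<le> t * (?w1 + ?w2)" using \<open>t > 0\<close> by simp
  moreover have "t * (?w1 + ?w2) \<le> ?gap"
    using B1.smoothing_gap_lower_bound[OF m1(2)] B2.smoothing_gap_lower_bound[OF m2(2)]
    unfolding gap distrib_left by (rule add_mono)
  moreover have "?gap \<le> t * (zeta_bar (K_const D1 \<phi>1 F1 X1 \<nu>1 A1 Y) \<nu>1 t
                + zeta_bar (K_const D2 \<phi>2 F2 X2 \<nu>2 A2 Y) \<nu>2 t)"
    using B1.smoothing_gap_upper_bound[OF \<open>bounded Y\<close> \<open>y \<in> Y\<close> m1(1)]
      B2.smoothing_gap_upper_bound[OF \<open>bounded Y\<close> \<open>y \<in> Y\<close> m2(1)]
    unfolding gap distrib_left by (rule add_mono)
  ultimately show ?thesis by blast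
qed

end
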